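(* Let $F_n$ denote the free group of rank $n$. If $n\ge 4$, then $\mathrm{Out}(F_n)$ contains infinitely many pairwise non-isomorphic McCool groups. If $n\ge 3$, then $\mathrm{Out}(F_n)$ contains infinitely many pairwise non-conjugate McCool groups.
   Context: For a family $\mathcal{H}=\{H_i\}$ of subgroups of a group $G$, an automorphism $\varphi\in\mathrm{Aut}(G)$, and its image $\Phi\in\mathrm{Out}(G)$, are said to act trivially on $\mathcal{H}$ if for each $i$ there is $g_i\in G$ such that $\varphi$ restricted to $H_i$ equals conjugation by $g_i$. The group $\mathrm{Mc}(\mathcal{H})\subset\mathrm{Out}(G)$ is the subgroup of all $\Phi$ acting trivially on $\mathcal{H}$. When $\mathcal{H}$ is a finite family of finitely generated subgroups, $\mathrm{Mc}(\mathcal{H})$ is called a McCool group of $G$ (or of $\mathrm{Out}(G)$). Conjugacy is conjugacy of subgroups in $\mathrm{Out}(F_n)$. *)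

theory Defs
  imports "HOL-Algebra.Coset" "HOL-Algebra.Bij" "HOL-Algebra.Generated_Groups"
begin

section \<open>Free groups\<close>

text \<open>
  The free group on a set \<open>B\<close> of generators: the elements are the reduced words in the letters
  \<open>(x, True)\<close> and \<open>(x, False)\<close> for \<open>x \<in> B\<close>, standing for \<open>x\<close> and its formal inverse,
  and the product of two words is the reduced form of their concatenation.
\<close>

definition letter_inv :: "'a \<times> bool \<Rightarrow> 'a \<times> bool"
  where "letter_inv a = (fst a, \<not> snd a)"

definition reduced :: "('a \<times> bool) list \<Rightarrow> bool"
  where "reduced w \<longleftrightarrow> successively (\<lambda>a b. b \<noteq> letter_inv a) w"

fun cancel_cons :: "'a \<times> bool \<Rightarrow> ('a \<times> bool) list \<Rightarrow> ('a \<times> bool) list"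
  where
    "cancel_cons a [] = [a]"
  | "cancel_cons a (b # w) = (if b = letter_inv a then w else a # b # w)"

definition free_group :: "'a set \<Rightarrow> ('a \<times> bool) list monoid"
  where "free_group B =
    \<lparr>carrier = {w. set w \<subseteq> B \<times> UNIV \<and> reduced w},
     mult = (\<lambda>u v. foldr cancel_cons u v),
     one = []\<rparr>"

abbreviation free_group_rank :: "nat \<Rightarrow> (nat \<times> bool) list monoid"
  where "free_group_rank n \<equiv> free_group {..<n}"

lemma letter_inv_letter_inv [simp]: "letter_inv (letter_inv a) = a"
  by (simp add: letter_inv_def)

lemma letter_inv_neq [simp]: "letter_inv a \<noteq> a" "a \<noteq> letter_inv a"
  by (auto simp: letter_inv_def prod_eq_iff)

lemma reduced_Nil [simp]: "reduced []"
  by (simp add: reduced_def)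

lemma reduced_Cons: "reduced (a # w) \<longleftrightarrow> reduced w \<and> (w = [] \<or> hd w \<noteq> letter_inv a)"
  by (auto simp: reduced_def successively_Cons)

lemma reduced_cancel_cons: "reduced w \<Longrightarrow> reduced (cancel_cons a w)"
  by (cases w) (auto simp: reduced_Cons)

lemma reduced_foldr: "reduced w \<Longrightarrow> reduced (foldr cancel_cons u w)"
  by (induction u) (auto simp: reduced_cancel_cons)

lemma cancel_cons_inverse: "reduced w \<Longrightarrow> cancel_cons a (cancel_cons (letter_inv a) w) = w"
  by (cases w; cases "tl w") (auto simp: reduced_Cons)

lemma set_cancel_cons: "set (cancel_cons a w) \<subseteq> insert a (set w)"
  by (cases w) auto

lemma set_foldr_cancel_cons: "set (foldr cancel_cons u w) \<subseteq> set u \<union> set w"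
  by (induction u) (use set_cancel_cons in fastforce)+

lemma foldr_cancel_cons_Nil: "reduced u \<Longrightarrow> foldr cancel_cons u [] = u"
proof (induction u)
  case (Cons a u)
  then show ?case by (cases u) (auto simp: reduced_Cons)
qed simp

lemma foldr_cancel_cons_step:
  "reduced w \<Longrightarrow> foldr cancel_cons (cancel_cons a u) w = cancel_cons a (foldr cancel_cons u w)"
  by (cases u) (auto simp: cancel_cons_inverse reduced_foldr)

lemma foldr_cancel_cons_assoc:
  "reduced w \<Longrightarrow>
    foldr cancel_cons (foldr cancel_cons u v) w = foldr cancel_cons u (foldr cancel_cons v w)"
  by (induction u) (auto simp: foldr_cancel_cons_step)

lemma foldr_cancel_cons_inverse:
  "reduced w \<Longrightarrow>
    foldr cancel_cons (rev (map letter_inv u)) (foldr cancel_cons u w) = w"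
proof (induction u)
  case (Cons a u)
  then show ?case
    using cancel_cons_inverse[of "foldr cancel_cons u w" "letter_inv a"]
    by (simp add: reduced_foldr)
qed simp

lemma group_free_group: "group (free_group B)"
proof (rule groupI)
  fix u v assume "u \<in> carrier (free_group B)" "v \<in> carrier (free_group B)"
  then show "u \<otimes>\<^bsub>free_group B\<^esub> v \<in> carrier (free_group B)"
    using set_foldr_cancel_cons[of u v] by (auto simp: free_group_def reduced_foldr)
next
  fix u assume u: "u \<in> carrier (free_group B)"
  let ?v = "foldr cancel_cons (rev (map letter_inv u)) []"
  have "set ?v \<subseteq> B \<times> UNIV"
    using u set_foldr_cancel_cons[of "rev (map letter_inv u)" "[]"]
    by (fastforce simp: free_group_def letter_inv_def)
  moreover have "foldr cancel_cons ?v u = []"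
    using u foldr_cancel_cons_inverse[of "[]" u]
    by (simp add: free_group_def foldr_cancel_cons_assoc foldr_cancel_cons_Nil)
  ultimately show "\<exists>v\<in>carrier (free_group B). v \<otimes>\<^bsub>free_group B\<^esub> u = \<one>\<^bsub>free_group B\<^esub>"
    by (intro bexI[of _ ?v]) (auto simp: free_group_def reduced_foldr)
qed (auto simp: free_group_def foldr_cancel_cons_assoc)

text \<open>The universal property of the free group with basis \<open>B\<close>.\<close>

lemma (in group) free_group_lift:
  assumes f: "f \<in> B \<rightarrow> carrier G"
  shows "\<exists>\<phi>\<in>hom (free_group B) G. \<forall>x\<in>B. \<phi> [(x, True)] = f x"
proof -
  define l where "l a = (if snd a then f (fst a) else inv (f (fst a)))" for a
  define \<phi> where "\<phi> w = foldr (\<lambda>a g. l a \<otimes> g) w \<one>" for w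
  have l: "l a \<in> carrier G" if "fst a \<in> B" for a
    using f that by (auto simp: l_def)
  have l_inv: "l a \<otimes> l (letter_inv a) = \<one>" if "fst a \<in> B" for a
    using f that by (auto simp: l_def letter_inv_def Pi_iff)
  have closed: "\<phi> w \<in> carrier G" if "set w \<subseteq> B \<times> UNIV" for w
    using that by (induction w) (auto simp: \<phi>_def intro!: m_closed l)
  have step: "\<phi> (cancel_cons a w) = l a \<otimes> \<phi> w"
    if "fst a \<in> B" "set w \<subseteq> B \<times> UNIV" for a w
  proof (cases w)
    case Nil
    then show ?thesis by (simp add: \<phi>_def)
  next
    case (Cons b v)
    have "\<phi> v \<in> carrier G" "l b \<in> carrier G"
      using that Cons by (auto intro!: closed l)
    moreover have "\<phi> (b # v) = l b \<otimes> \<phi> v" "\<phi> (a # b # v) = l a \<otimes> \<phi> (b # v)"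
      by (simp_all add: \<phi>_def)
    ultimately show ?thesis
      using Cons that l[of a] l_inv[of a] by (auto simp: m_assoc[symmetric])
  qed
  have mult: "\<phi> (foldr cancel_cons u v) = \<phi> u \<otimes> \<phi> v"
    if "set u \<subseteq> B \<times> UNIV" "set v \<subseteq> B \<times> UNIV" for u v
    using that
  proof (induction u)
    case Nil
    then show ?case using closed[of v] by (simp add: \<phi>_def)
  next
    case (Cons a u)
    have "set (foldr cancel_cons u v) \<subseteq> B \<times> UNIV"
      using Cons.prems set_foldr_cancel_cons[of u v] by auto
    moreover have "\<phi> (a # u) = l a \<otimes> \<phi> u" by (simp add: \<phi>_def)
    moreover have "l a \<in> carrier G" "\<phi> u \<in> carrier G" "\<phi> v \<in> carrier G"
      using Cons.prems by (auto intro!: closed l)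
    ultimately show ?case
      using Cons step[of a "foldr cancel_cons u v"] by (auto simp: m_assoc)
  qed
  have "\<phi> \<in> hom (free_group B) G"
    using closed mult by (auto simp: hom_def free_group_def)
  moreover have "\<forall>x\<in>B. \<phi> [(x, True)] = f x"
    using f by (auto simp: \<phi>_def l_def Pi_iff)
  ultimately show ?thesis by blast
qed

lemma free_group_generate:
  "generate (free_group B) ((\<lambda>x. [(x, True)]) ` B) = carrier (free_group B)"
proof -
  interpret F: group "free_group B" by (rule group_free_group)
  let ?L = "(\<lambda>x. [(x, True)]) ` B"
  have S: "?L \<subseteq> carrier (free_group B)"
    by (auto simp: free_group_def reduced_Cons)
  have letter: "[(x, b)] \<in> generate (free_group B) ?L" if "x \<in> B" for x b
  proof (cases b)
    case False
    have "inv\<^bsub>free_group B\<^esub> [(x, True)] = [(x, False)]"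
      using that
      by (intro F.inv_equality) (auto simp: free_group_def reduced_Cons letter_inv_def)
    then show ?thesis
      using generate.inv[of "[(x, True)]" ?L "free_group B"] that False by auto
  qed (use that in \<open>auto intro: generate.incl\<close>)
  have "w \<in> generate (free_group B) ?L" if "w \<in> carrier (free_group B)" for w
    using that
  proof (induction w)
    case Nil
    then show ?case using generate.one[of "free_group B" ?L] by (simp add: free_group_def)
  next
    case (Cons a w)
    then have "w \<in> generate (free_group B) ?L" "[a] \<in> generate (free_group B) ?L"
      using letter[of "fst a" "snd a"] by (auto simp: free_group_def reduced_Cons)
    then have "[a] \<otimes>\<^bsub>free_group B\<^esub> w \<in> generate (free_group B) ?L"
      by (rule generate.eng[rotated])
    then show ?case
      using Cons.prems by (cases w) (auto simp: free_group_def reduced_Cons)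
  qed
  then show ?thesis
    using F.generate_incl[OF S] by blast
qed


section \<open>Outer automorphism groups\<close>

definition inner_aut :: "('a, 'b) monoid_scheme \<Rightarrow> 'a \<Rightarrow> 'a \<Rightarrow> 'a"
  where "inner_aut G g = (\<lambda>x\<in>carrier G. g \<otimes>\<^bsub>G\<^esub> x \<otimes>\<^bsub>G\<^esub> inv\<^bsub>G\<^esub> g)"

definition Inn :: "('a, 'b) monoid_scheme \<Rightarrow> ('a \<Rightarrow> 'a) set"
  where "Inn G = inner_aut G ` carrier G"

definition Out :: "('a, 'b) monoid_scheme \<Rightarrow> ('a \<Rightarrow> 'a) set monoid"
  where "Out G = AutoGroup G Mod Inn G"

lemma AutoGroup_simps:
  "carrier (AutoGroup G) = auto G"
  "\<one>\<^bsub>AutoGroup G\<^esub> = (\<lambda>x\<in>carrier G. x)"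
  "\<phi> \<in> auto G \<Longrightarrow> \<psi> \<in> auto G \<Longrightarrow> \<phi> \<otimes>\<^bsub>AutoGroup G\<^esub> \<psi> = compose (carrier G) \<phi> \<psi>"
  by (auto simp: AutoGroup_def BijGroup_def auto_def)

lemma (in group) inner_aut_hom: "inner_aut G \<in> hom G (AutoGroup G)"
proof -
  have "inner_aut G g \<in> auto G" if g: "g \<in> carrier G" for g
  proof -
    have "bij_betw (inner_aut G g) (carrier G) (carrier G)"
      by (rule bij_betw_byWitness[where f' = "inner_aut G (inv g)"])
        (use g in \<open>auto simp: inner_aut_def m_assoc inv_solve_left'
          simp flip: m_assoc[of g "inv g"] m_assoc[of "inv g" g]\<close>)
    then show ?thesis
      using g by (auto simp: auto_def Bij_def hom_def inner_aut_def m_assoc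
          simp flip: m_assoc[of "inv g" g])
  qed
  then show ?thesis
    by (auto simp: hom_def AutoGroup_simps compose_def inner_aut_def m_assoc inv_mult_group)
qed

lemma (in group) normal_Inn: "Inn G \<lhd> AutoGroup G"
proof -
  interpret A: group "AutoGroup G" by (rule AutoGroup)
  interpret h: group_hom G "AutoGroup G" "inner_aut G"
    using inner_aut_hom by unfold_locales
  have sub: "subgroup (Inn G) (AutoGroup G)"
    unfolding Inn_def by (rule h.img_is_subgroup)
  have "\<phi> \<otimes>\<^bsub>AutoGroup G\<^esub> \<iota> \<otimes>\<^bsub>AutoGroup G\<^esub> inv\<^bsub>AutoGroup G\<^esub> \<phi> \<in> Inn G"
    if \<phi>: "\<phi> \<in> carrier (AutoGroup G)" and "\<iota> \<in> Inn G" for \<phi> \<iota>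
  proof -
    obtain g where g: "g \<in> carrier G" and \<iota>: "\<iota> = inner_aut G g"
      using \<open>\<iota> \<in> Inn G\<close> by (auto simp: Inn_def)
    interpret p: group_hom G G \<phi>
      using \<phi> by unfold_locales (auto simp: AutoGroup_simps auto_def)
    have *: "inner_aut G g \<in> auto G" "inner_aut G (\<phi> g) \<in> auto G" "\<phi> \<in> auto G"
      using g \<phi> h.hom_closed[of g] h.hom_closed[of "\<phi> g"] by (auto simp: AutoGroup_simps)
    have "\<phi> \<otimes>\<^bsub>AutoGroup G\<^esub> \<iota> = inner_aut G (\<phi> g) \<otimes>\<^bsub>AutoGroup G\<^esub> \<phi>"
      using g * by (auto simp: \<iota> AutoGroup_simps compose_def inner_aut_def fun_eq_iff)
    then have "\<phi> \<otimes>\<^bsub>AutoGroup G\<^esub> \<iota> \<otimes>\<^bsub>AutoGroup G\<^esub> inv\<^bsub>AutoGroup G\<^esub> \<phi> = inner_aut G (\<phi> g)"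
      using \<phi> *[folded AutoGroup_simps(1)[of G]] by (simp add: A.m_assoc)
    then show ?thesis using g by (auto simp: Inn_def)
  qed
  then show ?thesis using sub by (simp add: A.normal_inv_iff)
qed

lemma (in group) group_Out: "group (Out G)"
  unfolding Out_def using normal_Inn by (rule normal.factorgroup_is_group)


section \<open>McCool groups\<close>

definition acts_trivially_on ::
    "('a, 'b) monoid_scheme \<Rightarrow> 'a set set \<Rightarrow> ('a \<Rightarrow> 'a) \<Rightarrow> bool"
  where "acts_trivially_on G \<H> \<phi> \<longleftrightarrow>
    (\<forall>H\<in>\<H>. \<exists>g\<in>carrier G. \<forall>h\<in>H. \<phi> h = g \<otimes>\<^bsub>G\<^esub> h \<otimes>\<^bsub>G\<^esub> inv\<^bsub>G\<^esub> g)"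

text \<open>
  The elements of \<open>carrier (Out G)\<close> are cosets of \<open>Inn G\<close>, that is, the sets of automorphisms
  representing the given outer automorphism. Whether such a representative acts trivially
  does not depend on its choice.
\<close>

definition Mc :: "('a, 'b) monoid_scheme \<Rightarrow> 'a set set \<Rightarrow> ('a \<Rightarrow> 'a) set set"
  where "Mc G \<H> = {\<Phi> \<in> carrier (Out G). \<exists>\<phi>\<in>\<Phi>. acts_trivially_on G \<H> \<phi>}"

definition finitely_generated :: "('a, 'b) monoid_scheme \<Rightarrow> 'a set \<Rightarrow> bool"
  where "finitely_generated G H \<longleftrightarrow> (\<exists>S\<subseteq>carrier G. finite S \<and> H = generate G S)"

definition McCool_group :: "('a, 'b) monoid_scheme \<Rightarrow> ('a \<Rightarrow> 'a) set set \<Rightarrow> bool"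
  where "McCool_group G M \<longleftrightarrow>
    (\<exists>\<H>. finite \<H> \<and> (\<forall>H\<in>\<H>. subgroup H G \<and> finitely_generated G H) \<and> M = Mc G \<H>)"

definition conjugate_subgroups :: "('a, 'b) monoid_scheme \<Rightarrow> 'a set \<Rightarrow> 'a set \<Rightarrow> bool"
  where "conjugate_subgroups G A B \<longleftrightarrow>
    (\<exists>g\<in>carrier G. B = g <#\<^bsub>G\<^esub> A #>\<^bsub>G\<^esub> inv\<^bsub>G\<^esub> g)"

end

theory Submission
  imports Defs "HOL-Number_Theory.Cong"
begin

text \<open>
  Let \<open>h = a\<^sup>p b\<^sup>p\<close> with \<open>p\<close> prime, where \<open>a, b\<close> are two elements of a basis, let \<open>c\<close> be a
  further basis element, and let \<open>H\<^sub>0\<close> be generated by \<open>c\<inverse> h c\<close> and all basis elements other than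
  \<open>c\<close> (and, in the first part, other than one more element \<open>t\<close>). An outer automorphism acting
  trivially on \<open>H\<^sub>0\<close> has a representative that is the identity on \<open>H\<^sub>0\<close>; it maps \<open>c\<close> to some \<open>d\<close>
  for which \<open>d c\<inverse>\<close> centralizes \<open>h\<close>, so \<open>d = h\<^sup>m c\<close> because \<open>h\<close> is not a proper power.

  If there is no \<open>t\<close>, the McCool group of \<open>H\<^sub>0\<close> is generated by \<open>c \<mapsto> h c\<close>. It acts trivially on the
  homology modulo a prime \<open>q\<close> if and only if \<open>q = p\<close>, and this is invariant under conjugacy.

  If there is a \<open>t\<close>, let the family consist of \<open>H\<^sub>0\<close> and the group generated by \<open>t\<close>. With \<open>A\<close>
  generated by the basis elements other than \<open>t\<close>, the representatives also map \<open>t\<close> to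
  \<open>g t g\<inverse>\<close>, and surjectivity forces \<open>g \<in> A\<close> up to a power of \<open>t\<close>. So the McCool group is an
  extension of \<open>\<int>\<close> by \<open>A\<close>, formed with \<open>c \<mapsto> h c\<close>. Its abelianization has torsion of order
  exactly \<open>p\<close>, generated by the class of \<open>a b\<close>; hence every homomorphism to \<open>\<int>/q\<close> lifts to \<open>\<int>\<close>
  for a prime \<open>q \<noteq> p\<close>, but not for \<open>q = p\<close>.
\<close>

section \<open>Words in free groups\<close>

abbreviation gen :: "'a \<Rightarrow> ('a \<times> bool) list"
  where "gen x \<equiv> [(x, True)]"

section \<open>Formal inverses and reduced words\<close>

definition word_inv :: "('a \<times> bool) list \<Rightarrow> ('a \<times> bool) list"
  where "word_inv w = rev (map letter_inv w)"

lemma word_inv_simps [simp]: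
  "word_inv [] = []" "word_inv (a # w) = word_inv w @ [letter_inv a]"
  "word_inv (u @ v) = word_inv v @ word_inv u" "word_inv (word_inv w) = w"
  "word_inv w = [] \<longleftrightarrow> w = []"
  by (auto simp: word_inv_def rev_map o_def)

lemma hd_word_inv: "w \<noteq> [] \<Longrightarrow> hd (word_inv w) = letter_inv (last w)"
  by (simp add: word_inv_def hd_rev last_map)

lemma last_word_inv: "w \<noteq> [] \<Longrightarrow> last (word_inv w) = letter_inv (hd w)"
  by (simp add: word_inv_def last_rev hd_map)

lemma fst_letter_inv [simp]: "fst (letter_inv a) = fst a"
  by (simp add: letter_inv_def)

lemma fst_set_word_inv [simp]: "fst ` set (word_inv w) = fst ` set w"
  by (simp add: word_inv_def image_image)

lemma letter_inv_eq_iff [simp]: "letter_inv a = letter_inv b \<longleftrightarrow> a = b"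
  by (metis letter_inv_letter_inv)

lemma reduced_append:
  "reduced (u @ v) \<longleftrightarrow> reduced u \<and> reduced v \<and> (u = [] \<or> v = [] \<or> hd v \<noteq> letter_inv (last u))"
  by (auto simp: reduced_def successively_append_iff)

lemma reduced_word_inv [simp]: "reduced (word_inv w) \<longleftrightarrow> reduced w"
proof -
  have "reduced (word_inv w)" if "reduced w" for w :: "('a \<times> bool) list"
    using that
    by (induction w)
      (auto simp: reduced_append reduced_Cons last_word_inv)
  from this[of w] this[of "word_inv w"] show ?thesis by auto
qed

lemma set_subset_times_UNIV: "set w \<subseteq> B \<times> UNIV \<longleftrightarrow> fst ` set w \<subseteq> B"
  by auto

section \<open>Group operations on reduced words\<close>

lemma carrier_free_group: "w \<in> carrier (free_group B) \<longleftrightarrow> fst ` set w \<subseteq> B \<and> reduced w"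
  by (auto simp: free_group_def set_subset_times_UNIV)

lemma one_free_group: "\<one>\<^bsub>free_group B\<^esub> = []"
  by (simp add: free_group_def)

lemma mult_free_group: "u \<otimes>\<^bsub>free_group B\<^esub> v = foldr cancel_cons u v"
  by (simp add: free_group_def)

lemma foldr_cancel_cons_append:
  "reduced (u @ v) \<Longrightarrow> foldr cancel_cons u v = u @ v"
proof (induction u)
  case (Cons a u)
  then show ?case by (cases "u @ v") (auto simp: reduced_Cons)
qed simp

lemma mult_eq_append: "reduced (u @ v) \<Longrightarrow> u \<otimes>\<^bsub>free_group B\<^esub> v = u @ v"
  by (simp add: mult_free_group foldr_cancel_cons_append)

text \<open>Length is subadditive; \<open>commuting_words\<close> compares lengths to detect whether
  a product cancels.\<close>

lemma length_foldr_cancel_cons: "length (foldr cancel_cons u v) \<le> length u + length v"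
proof (induction u)
  case (Cons a u)
  have "length (cancel_cons a w) \<le> Suc (length w)" for w :: "('a \<times> bool) list"
    by (cases w) auto
  from this[of "foldr cancel_cons u v"] Cons show ?case by simp
qed simp

lemma inv_free_group:
  assumes "w \<in> carrier (free_group B)"
  shows "inv\<^bsub>free_group B\<^esub> w = word_inv w"
proof -
  interpret group "free_group B" by (rule group_free_group)
  have "word_inv w \<in> carrier (free_group B)"
    using assms by (simp add: carrier_free_group)
  moreover have "foldr cancel_cons (word_inv w) w = []"
    using foldr_cancel_cons_inverse[of "[]" w] assms
    by (simp add: word_inv_def foldr_cancel_cons_Nil carrier_free_group)
  ultimately show ?thesis
    using assms by (intro inv_equality) (simp_all add: mult_free_group one_free_group)
qed

lemma gen_in_carrier [simp]: "gen x \<in> carrier (free_group B) \<longleftrightarrow> x \<in> B"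
  by (simp add: carrier_free_group reduced_Cons)

lemma free_group_mono: "B \<subseteq> C \<Longrightarrow> w \<in> carrier (free_group B) \<Longrightarrow> w \<in> carrier (free_group C)"
  by (auto simp: carrier_free_group)

lemma free_group_subgroup:
  assumes "B \<subseteq> C"
  shows "subgroup (carrier (free_group B)) (free_group C)"
proof -
  interpret B: group "free_group B" by (rule group_free_group)
  interpret C: group "free_group C" by (rule group_free_group)
  show ?thesis
  proof (rule C.subgroupI)
    show "carrier (free_group B) \<subseteq> carrier (free_group C)"
      using free_group_mono[OF assms] by auto
    show "carrier (free_group B) \<noteq> {}" using B.one_closed by blast
    fix a assume a: "a \<in> carrier (free_group B)"
    then show "inv\<^bsub>free_group C\<^esub> a \<in> carrier (free_group B)"
      using B.inv_closed[OF a] free_group_mono[OF assms a] by (simp add: inv_free_group)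
    fix b assume b: "b \<in> carrier (free_group B)"
    show "a \<otimes>\<^bsub>free_group C\<^esub> b \<in> carrier (free_group B)"
      using B.m_closed[OF a b] by (simp add: mult_free_group)
  qed
qed

section \<open>Induction over words and homomorphisms out of free groups\<close>

text \<open>Prepending a letter to a reduced word is multiplication by a generator or its inverse.
  Stating the steps with the group operations lets homomorphisms be applied to them
  directly.\<close>

lemma free_group_induct [consumes 1, case_names one gen inv]:
  assumes "w \<in> carrier (free_group B)"
    and "P []"
    and "\<And>x w. x \<in> B \<Longrightarrow> w \<in> carrier (free_group B) \<Longrightarrow> P w \<Longrightarrow> P (gen x \<otimes>\<^bsub>free_group B\<^esub> w)"
    and "\<And>x w. x \<in> B \<Longrightarrow> w \<in> carrier (free_group B) \<Longrightarrow> P w \<Longrightarrow>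
      P (inv\<^bsub>free_group B\<^esub> (gen x) \<otimes>\<^bsub>free_group B\<^esub> w)"
  shows "P w"
  using assms(1)
proof (induction w)
  case (Cons a w)
  obtain x e where a: "a = (x, e)" by (cases a)
  have w: "w \<in> carrier (free_group B)" "x \<in> B"
    using Cons.prems by (auto simp: carrier_free_group reduced_Cons a)
  have *: "[a] \<otimes>\<^bsub>free_group B\<^esub> w = a # w"
    using Cons.prems by (subst mult_eq_append) (auto simp: carrier_free_group)
  show ?case
  proof (cases e)
    case True
    then show ?thesis using assms(3)[OF w(2,1) Cons.IH[OF w(1)]] * a by simp
  next
    case False
    then have "inv\<^bsub>free_group B\<^esub> (gen x) = [a]"
      using w by (subst inv_free_group) (auto simp: letter_inv_def a)
    then show ?thesis using assms(4)[OF w(2,1) Cons.IH[OF w(1)]] * by simp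
  qed
qed (rule assms(2))

lemma hom_free_group_eqI:
  assumes "group G" "\<phi> \<in> hom (free_group B) G" "\<psi> \<in> hom (free_group B) G"
    and "\<And>x. x \<in> B \<Longrightarrow> \<phi> (gen x) = \<psi> (gen x)" and "w \<in> carrier (free_group B)"
  shows "\<phi> w = \<psi> w"
proof -
  interpret F: group "free_group B" by (rule group_free_group)
  interpret G: group G by fact
  interpret f: group_hom "free_group B" G \<phi> using assms by unfold_locales
  interpret g: group_hom "free_group B" G \<psi> using assms by unfold_locales
  have 1: "gen x \<in> carrier (free_group B)" if "x \<in> B" for x using that by simp
  show ?thesis
    using assms(5)
  proof (induction rule: free_group_induct)
    case one
    then show ?case using f.hom_one g.hom_one by (simp add: one_free_group)
  next
    case (gen x w)
    show ?case using 1[OF gen(1)] gen assms(4) by (simp del: gen_in_carrier)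
  next
    case (inv x w)
    show ?case using 1[OF inv(1)] inv assms(4) by (simp del: gen_in_carrier)
  qed
qed

text \<open>The restriction to the carrier makes the chosen homomorphism extensional, as membership
  in \<open>auto\<close> requires.\<close>

definition lift :: "('b, 'c) monoid_scheme \<Rightarrow> 'a set \<Rightarrow> ('a \<Rightarrow> 'b) \<Rightarrow> ('a \<times> bool) list \<Rightarrow> 'b"
  where "lift G B f = restrict
    (SOME \<phi>. \<phi> \<in> hom (free_group B) G \<and> (\<forall>x\<in>B. \<phi> (gen x) = f x)) (carrier (free_group B))"

lemma
  assumes "group G" "f \<in> B \<rightarrow> carrier G"
  shows lift_hom: "lift G B f \<in> hom (free_group B) G"
    and lift_gen: "\<And>x. x \<in> B \<Longrightarrow> lift G B f (gen x) = f x"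
    and lift_extensional: "lift G B f \<in> extensional (carrier (free_group B))"
proof -
  interpret F: group "free_group B" by (rule group_free_group)
  define \<phi> where "\<phi> = (SOME \<phi>. \<phi> \<in> hom (free_group B) G \<and> (\<forall>x\<in>B. \<phi> (gen x) = f x))"
  have "\<phi> \<in> hom (free_group B) G \<and> (\<forall>x\<in>B. \<phi> (gen x) = f x)"
    unfolding \<phi>_def
    by (rule someI_ex[where P = "\<lambda>\<phi>. \<phi> \<in> hom (free_group B) G \<and> (\<forall>x\<in>B. \<phi> (gen x) = f x)"])
      (use group.free_group_lift[OF assms] in blast)
  then have \<phi>: "\<phi> \<in> hom (free_group B) G" "\<And>x. x \<in> B \<Longrightarrow> \<phi> (gen x) = f x" by auto
  have eq: "lift G B f = restrict \<phi> (carrier (free_group B))"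
    by (simp add: lift_def \<phi>_def)
  show "lift G B f \<in> hom (free_group B) G"
    unfolding eq by (rule F.hom_restrict[OF \<phi>(1)]) simp
  show "lift G B f (gen x) = f x" if "x \<in> B" for x
    using that by (simp add: eq \<phi>(2))
  show "lift G B f \<in> extensional (carrier (free_group B))"
    by (simp add: eq)
qed


section \<open>Commuting elements\<close>

text \<open>Since \<open>h\<close> is cyclically reduced, equal lengths force the two products to be
  both free of cancellation or both cancelling. In the second case the inverse of \<open>d\<close>
  has no cancellation with \<open>h\<close> on either side, so commutation in the group becomes
  commutation of concatenations.\<close>

lemma commuting_words:
  assumes h: "h \<in> carrier (free_group B)" "h \<noteq> []" "hd h \<noteq> letter_inv (last h)"
    and d: "d \<in> carrier (free_group B)"
    and comm: "d \<otimes>\<^bsub>free_group B\<^esub> h = h \<otimes>\<^bsub>free_group B\<^esub> d"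
  shows "\<exists>e\<in>{d, word_inv d}. e @ h = h @ e"
proof -
  interpret group "free_group B" by (rule group_free_group)
  have red: "reduced h" "reduced d" using h d by (auto simp: carrier_free_group)
  \<comment> \<open>A cancelling pair at the junction shortens the product strictly, so full length
    characterizes the absence of cancellation.\<close>
  have len: "length (u \<otimes>\<^bsub>free_group B\<^esub> v) < length u + length v"
    if v0: "u \<noteq> []" "v \<noteq> []" "hd v = letter_inv (last u)"
    for u v :: "('a \<times> bool) list"
  proof -
    obtain v' where v: "v = letter_inv (last u) # v'" using v0 by (cases v) auto
    obtain u' where u: "u = u' @ [last u]" using v0(1) by (metis append_butlast_last_id)
    have "foldr cancel_cons u v = foldr cancel_cons u' v'"
      by (subst u) (simp add: v)
    then show ?thesis
      using length_foldr_cancel_cons[of u' v'] arg_cong[OF u, of length] v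
      by (simp add: mult_free_group)
  qed
  have nolen: "length (u \<otimes>\<^bsub>free_group B\<^esub> v) = length u + length v"
    if "\<not> (u \<noteq> [] \<and> v \<noteq> [] \<and> hd v = letter_inv (last u))" "reduced u" "reduced v"
    for u v :: "('a \<times> bool) list"
    using that by (subst mult_eq_append) (auto simp: reduced_append)
  show ?thesis
  proof (cases "d \<noteq> [] \<and> hd d = letter_inv (last h)")
    case False
    then have 1: "h \<otimes>\<^bsub>free_group B\<^esub> d = h @ d"
      using red by (intro mult_eq_append) (auto simp: reduced_append)
    \<comment> \<open>The two products are equal, hence of equal length; full length in one order
      rules out cancellation in the other.\<close>
    have "\<not> (d \<noteq> [] \<and> h \<noteq> [] \<and> hd h = letter_inv (last d))"
      using len[of d h] nolen[of h d] red False comm by auto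
    then have "d \<otimes>\<^bsub>free_group B\<^esub> h = d @ h"
      using red by (intro mult_eq_append) (auto simp: reduced_append)
    with 1 comm show ?thesis by auto
  next
    case True
    then have 1: "d \<noteq> []" "hd h = letter_inv (last d)"
      using nolen[of d h] len[of h d] red h comm by auto
    let ?e = "inv\<^bsub>free_group B\<^esub> d"
    have e: "?e = word_inv d" using d by (rule inv_free_group)
    have "?e \<otimes>\<^bsub>free_group B\<^esub> h = h \<otimes>\<^bsub>free_group B\<^esub> ?e"
    proof -
      have "?e \<otimes>\<^bsub>free_group B\<^esub> h =
          ?e \<otimes>\<^bsub>free_group B\<^esub> (h \<otimes>\<^bsub>free_group B\<^esub> d) \<otimes>\<^bsub>free_group B\<^esub> ?e"
        using d h by (simp add: m_assoc)
      also have "\<dots> = ?e \<otimes>\<^bsub>free_group B\<^esub> (d \<otimes>\<^bsub>free_group B\<^esub> h) \<otimes>\<^bsub>free_group B\<^esub> ?e"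
        by (simp only: comm)
      also have "\<dots> = h \<otimes>\<^bsub>free_group B\<^esub> ?e"
        using d h by (simp flip: m_assoc[of ?e d h])
      finally show ?thesis .
    qed
    \<comment> \<open>The inverse of \<open>d\<close> ends with the last letter of \<open>h\<close>
      and begins with its first letter, so cyclic reducedness of \<open>h\<close> prevents
      cancellation at both junctions.\<close>
    moreover have "?e \<otimes>\<^bsub>free_group B\<^esub> h = ?e @ h"
      using True 1 h red by (intro mult_eq_append)
        (auto simp: e reduced_append last_word_inv)
    moreover have "h \<otimes>\<^bsub>free_group B\<^esub> ?e = h @ ?e"
      using True 1 h red by (intro mult_eq_append)
        (auto simp: e reduced_append hd_word_inv)
    ultimately show ?thesis using e by auto
  qed
qed

lemma append_singleton_commute: "e @ [a] = a # e \<Longrightarrow> set e \<subseteq> {a}"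
  by (induction e) auto

text \<open>A word that commutes with a single letter under concatenation is a power of it; only the
  resulting bound on the support is kept.\<close>

lemma centralizer_gen:
  assumes "x \<in> B" "z \<in> carrier (free_group B)"
    and "z \<otimes>\<^bsub>free_group B\<^esub> gen x = gen x \<otimes>\<^bsub>free_group B\<^esub> z"
  shows "fst ` set z \<subseteq> {x}"
proof -
  obtain e where e: "e \<in> {z, word_inv z}" "e @ gen x = gen x @ e"
    using commuting_words[of "gen x" B z] assms by auto
  then have "fst ` set e \<subseteq> {x}"
    using append_singleton_commute[of e "(x, True)"] by auto
  moreover have "fst ` set e = fst ` set z" using e(1) by (elim insertE) simp_all
  ultimately show ?thesis by simp
qed

text \<open>The support lies in two disjoint singletons. This is what removes the inner ambiguity
  between twists.\<close>

lemma centralizer_two_gens_trivial: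
  assumes "x \<in> B" "y \<in> B" "x \<noteq> y" "z \<in> carrier (free_group B)"
    and "z \<otimes>\<^bsub>free_group B\<^esub> gen x = gen x \<otimes>\<^bsub>free_group B\<^esub> z"
    and "z \<otimes>\<^bsub>free_group B\<^esub> gen y = gen y \<otimes>\<^bsub>free_group B\<^esub> z"
  shows "z = []"
  using centralizer_gen[OF assms(1,4,5)] centralizer_gen[OF assms(2,4,6)] assms(3)
  by (cases z) auto

section \<open>The word a^p b^p and its centralizer\<close>

text \<open>The generators \<open>0\<close> and \<open>1\<close> stand for \<open>a\<close> and
  \<open>b\<close>, so that the order of the indices can be used to show that the word is not a
  proper power.\<close>

definition hword :: "nat \<Rightarrow> (nat \<times> bool) list"
  where "hword p = replicate p (0, True) @ replicate p (1, True)"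

lemma reduced_replicate: "reduced (replicate p a)"
  by (induction p) (auto simp: reduced_Cons hd_replicate)

lemma hword_carrier: "{0, 1} \<subseteq> B \<Longrightarrow> hword p \<in> carrier (free_group B)"
  by (auto simp: carrier_free_group hword_def reduced_append reduced_replicate letter_inv_def)

text \<open>In a proper power, the last letter \<open>b\<close> of the first copy would precede the
  first letter \<open>a\<close> of the second, whereas the letters of \<open>hword p\<close> are
  sorted by index.\<close>

lemma hword_primitive:
  assumes "p > 0" "concat (replicate k zs) = hword p"
  shows "k = 1"
proof (rule ccontr)
  assume "k \<noteq> 1"
  moreover have "k \<noteq> 0"
  proof
    assume "k = 0"
    then show False using assms by (cases p) (auto simp: hword_def)
  qed
  ultimately obtain j where k: "k = Suc (Suc j)" by (metis One_nat_def not0_implies_Suc)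
  have zs: "zs \<noteq> []" using assms by (auto simp: hword_def)
  let ?a = "(0::nat, True)" and ?b = "(1::nat, True)"
  have sorted: "sorted (map fst (hword p))" by (simp add: hword_def sorted_append)
  have split: "hword p = zs @ zs @ concat (replicate j zs)" using assms(2) k by simp
  have split': "hword p = concat (replicate (Suc j) zs) @ zs"
  proof -
    have "concat (replicate j zs) @ zs = zs @ concat (replicate j zs)" by (induction j) auto
    then show ?thesis using split by simp
  qed
  have "hd (hword p) = ?a" using assms(1) by (cases p) (auto simp: hword_def)
  then have a: "hd zs = ?a" using zs split by (metis hd_append2)
  have "last (hword p) = ?b" using assms(1) by (cases p) (auto simp: hword_def)
  then have b: "last zs = ?b" using zs split' by (metis last_append append_is_Nil_conv)
  have "?b \<in> set zs" "?a \<in> set zs"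
    using last_in_set[OF zs] hd_in_set[OF zs] a b by simp_all
  \<comment> \<open>Sortedness across the first two copies bounds every index in \<open>zs\<close>
    by every other, although both \<open>0\<close> and \<open>1\<close> occur.\<close>
  moreover have "\<forall>x\<in>fst ` set zs. \<forall>y\<in>fst ` set zs. x \<le> y"
    using sorted unfolding split by (auto simp: sorted_append)
  ultimately show False by force
qed

text \<open>Two words that commute under concatenation are powers of a common word; by primitivity
  that word is \<open>hword p\<close> itself.\<close>

lemma centralizer_hword:
  assumes B: "{0, 1} \<subseteq> B" and p: "p > 0" and d: "d \<in> carrier (free_group B)"
    and comm: "d \<otimes>\<^bsub>free_group B\<^esub> hword p = hword p \<otimes>\<^bsub>free_group B\<^esub> d"
  shows "\<exists>m::int. d = hword p [^]\<^bsub>free_group B\<^esub> m"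
proof -
  interpret group "free_group B" by (rule group_free_group)
  note h = hword_carrier[OF B, of p]
  have h0: "hword p \<noteq> []" "hd (hword p) \<noteq> letter_inv (last (hword p))"
    using p by (cases p; simp add: hword_def letter_inv_def)+
  \<comment> \<open>Because \<open>hword p\<close> is cyclically reduced, its repeated
    concatenations are reduced and hence agree with its powers in the group.\<close>
  have red: "reduced (concat (replicate m (hword p))) \<and>
      (m > 0 \<longrightarrow> hd (concat (replicate m (hword p))) = hd (hword p))" for m
    using h h0 by (induction m) (auto simp: reduced_append carrier_free_group)
  have pow: "concat (replicate m (hword p)) = hword p [^]\<^bsub>free_group B\<^esub> m" for m :: nat
  proof (induction m)
    case (Suc m)
    have "hword p [^]\<^bsub>free_group B\<^esub> Suc m =
        hword p \<otimes>\<^bsub>free_group B\<^esub> concat (replicate m (hword p))"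
      using Suc h by (simp only: nat_pow_Suc2)
    also have "\<dots> = hword p @ concat (replicate m (hword p))"
      using red[of "Suc m"] by (intro mult_eq_append) simp
    finally show ?case by simp
  qed (simp add: one_free_group)
  obtain e where e: "e \<in> {d, word_inv d}" "e @ hword p = hword p @ e"
    using commuting_words[OF h h0 d comm] by blast
  from comm_append_are_replicate[OF e(2)] obtain m k zs where
    zs: "concat (replicate m zs) = e" "concat (replicate k zs) = hword p" by blast
  then have "zs = hword p" using hword_primitive[OF p, of k zs] by simp
  with zs pow have em: "e = hword p [^]\<^bsub>free_group B\<^esub> int m"
    by (simp add: int_pow_int)
  show ?thesis
  proof (cases "e = d")
    case False
    then have "e = inv\<^bsub>free_group B\<^esub> d" using e(1) d by (simp add: inv_free_group)
    from this[symmetric] have "d = inv\<^bsub>free_group B\<^esub> e" using d by (metis inv_inv)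
    also have "\<dots> = hword p [^]\<^bsub>free_group B\<^esub> (- int m)"
      using em h by (simp add: int_pow_neg)
    finally show ?thesis by blast
  qed (use em in blast)
qed

section \<open>Homomorphisms to cyclic groups\<close>

text \<open>For \<open>j = 0\<close> these are the homomorphisms to the integers.\<close>

definition additive_mod :: "int \<Rightarrow> ('a, 'b) monoid_scheme \<Rightarrow> ('a \<Rightarrow> int) \<Rightarrow> bool"
  where "additive_mod j G f \<longleftrightarrow>
    (\<forall>x\<in>carrier G. \<forall>y\<in>carrier G. [f (x \<otimes>\<^bsub>G\<^esub> y) = f x + f y] (mod j))"

lemma additive_modD:
  "additive_mod j G f \<Longrightarrow> x \<in> carrier G \<Longrightarrow> y \<in> carrier G \<Longrightarrow>
    [f (x \<otimes>\<^bsub>G\<^esub> y) = f x + f y] (mod j)"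
  by (simp add: additive_mod_def)

text \<open>The homomorphism to the integers with value \<open>v x\<close> on each basis element
  \<open>x\<close>, written for arbitrary words so that it applies to concatenations as
  well.\<close>

definition exponent_sum :: "('a \<Rightarrow> int) \<Rightarrow> ('a \<times> bool) list \<Rightarrow> int"
  where "exponent_sum v w = (\<Sum>a\<leftarrow>w. if snd a then v (fst a) else - v (fst a))"

lemma exponent_sum_simps [simp]:
  "exponent_sum v [] = 0"
  "exponent_sum v (a # w) = (if snd a then v (fst a) else - v (fst a)) + exponent_sum v w"
  by (auto simp: exponent_sum_def)

lemma exponent_sum_cancel_cons:
  "exponent_sum v (cancel_cons a w) = (if snd a then v (fst a) else - v (fst a)) + exponent_sum v w"
  by (cases w) (auto simp: letter_inv_def)

lemma exponent_sum_mult [simp]: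
  "exponent_sum v (x \<otimes>\<^bsub>free_group B\<^esub> y) = exponent_sum v x + exponent_sum v y"
  unfolding mult_free_group by (induction x) (auto simp: exponent_sum_cancel_cons)

lemma exponent_sum_append [simp]: "exponent_sum v (x @ y) = exponent_sum v x + exponent_sum v y"
  by (simp add: exponent_sum_def)

lemma exponent_sum_word_inv [simp]: "exponent_sum v (word_inv w) = - exponent_sum v w"
  by (induction w) (auto simp: letter_inv_def)

lemma exponent_sum_inv [simp]:
  "w \<in> carrier (free_group B) \<Longrightarrow> exponent_sum v (inv\<^bsub>free_group B\<^esub> w) = - exponent_sum v w"
  by (simp add: inv_free_group)

lemma exponent_sum_hword: "exponent_sum v (hword p) = int p * (v 0 + v 1)"
  by (simp add: hword_def exponent_sum_def sum_list_replicate algebra_simps)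

lemma exponent_sum_int_pow:
  assumes "w \<in> carrier (free_group B)"
  shows "exponent_sum v (w [^]\<^bsub>free_group B\<^esub> (m::int)) = m * exponent_sum v w"
proof -
  interpret group "free_group B" by (rule group_free_group)
  have nat: "exponent_sum v (w [^]\<^bsub>free_group B\<^esub> (k::nat)) = int k * exponent_sum v w" for k
    by (induction k) (simp_all add: one_free_group algebra_simps)
  show ?thesis
  proof (cases "m \<ge> 0")
    case True
    then show ?thesis using nat[of "nat m"] by (metis int_nat_eq int_pow_int)
  next
    case False
    then have "m = - int (nat (- m))" by simp
    then have "w [^]\<^bsub>free_group B\<^esub> m = inv\<^bsub>free_group B\<^esub> (w [^]\<^bsub>free_group B\<^esub> nat (- m))"
      using assms by (metis int_pow_int int_pow_neg)
    then show ?thesis using nat[of "nat (- m)"] assms False by simp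
  qed
qed

lemma additive_mod_one:
  assumes "group G" "additive_mod j G f"
  shows "[f \<one>\<^bsub>G\<^esub> = 0] (mod j)"
proof -
  interpret group G by fact
  have "[f \<one>\<^bsub>G\<^esub> + 0 = f \<one>\<^bsub>G\<^esub> + f \<one>\<^bsub>G\<^esub>] (mod j)"
    using additive_modD[OF assms(2) one_closed one_closed] by simp
  then show ?thesis by (simp only: cong_add_lcancel) (rule cong_sym)
qed

lemma additive_mod_inv:
  assumes "group G" "additive_mod j G f" "x \<in> carrier G"
  shows "[f (inv\<^bsub>G\<^esub> x) = - f x] (mod j)"
proof -
  interpret group G by fact
  have "[f (inv\<^bsub>G\<^esub> x) + f x = f \<one>\<^bsub>G\<^esub>] (mod j)"
    using additive_modD[OF assms(2) inv_closed[OF assms(3)] assms(3)] assms(3)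
    by (simp add: cong_sym_eq)
  then have "[f (inv\<^bsub>G\<^esub> x) + f x = - f x + f x] (mod j)"
    using additive_mod_one[OF assms(1,2)] by (metis add.left_inverse cong_trans)
  then show ?thesis by (simp only: cong_add_rcancel)
qed

text \<open>Values on the basis determine a homomorphism to a cyclic group, so modulo
  \<open>j\<close> every such homomorphism is an exponent sum.\<close>

lemma additive_mod_eq_exponent_sum:
  assumes f: "additive_mod j (free_group B) f" and "w \<in> carrier (free_group B)"
  shows "[f w = exponent_sum (\<lambda>x. f (gen x)) w] (mod j)"
  using assms(2)
proof (induction rule: free_group_induct)
  interpret group "free_group B" by (rule group_free_group)
  case one
  show ?case
    using additive_mod_one[OF is_group f] by (simp add: one_free_group)
next
  interpret group "free_group B" by (rule group_free_group)
  case (gen x w)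
  have "[f (gen x \<otimes>\<^bsub>free_group B\<^esub> w) = f (gen x) + f w] (mod j)"
    using additive_modD[OF f _ gen(2), of "gen x"] gen(1) by simp
  then show ?case
    using gen(3) by (simp add: cong_add_lcancel cong_trans)
next
  interpret group "free_group B" by (rule group_free_group)
  case (inv x w)
  have x: "gen x \<in> carrier (free_group B)" using inv by simp
  have "[f (inv\<^bsub>free_group B\<^esub> (gen x) \<otimes>\<^bsub>free_group B\<^esub> w) =
      f (inv\<^bsub>free_group B\<^esub> (gen x)) + f w] (mod j)"
    using additive_modD[OF f inv_closed[OF x] inv(2)] .
  also have "[f (inv\<^bsub>free_group B\<^esub> (gen x)) + f w =
      - f (gen x) + exponent_sum (\<lambda>x. f (gen x)) w] (mod j)"
    using inv(3) additive_mod_inv[OF is_group f x] by (rule cong_add[rotated])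
  finally show ?case using inv(1) by simp
qed

lemma exponent_sum_cong:
  "(\<And>x. x \<in> fst ` set w \<Longrightarrow> [v x = v' x] (mod j)) \<Longrightarrow>
    [exponent_sum v w = exponent_sum v' w] (mod j)"
proof (induction w)
  case (Cons a w)
  then have "[v (fst a) = v' (fst a)] (mod j)" "[exponent_sum v w = exponent_sum v' w] (mod j)"
    by simp_all
  moreover from this(1) have "[- v (fst a) = - v' (fst a)] (mod j)"
    by (simp only: cong_minus_minus_iff)
  ultimately show ?case
    unfolding exponent_sum_simps by (intro cong_add) simp_all
qed simp

lemma additive_mod_eqI:
  assumes "additive_mod j (free_group B) f" "additive_mod j (free_group B) g"
    and "\<And>x. x \<in> B \<Longrightarrow> [f (gen x) = g (gen x)] (mod j)" and w: "w \<in> carrier (free_group B)"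
  shows "[f w = g w] (mod j)"
proof -
  have "[exponent_sum (\<lambda>x. f (gen x)) w = exponent_sum (\<lambda>x. g (gen x)) w] (mod j)"
    by (rule exponent_sum_cong) (use assms in \<open>auto simp: carrier_free_group\<close>)
  from additive_mod_eq_exponent_sum[OF assms(1) w] this
    additive_mod_eq_exponent_sum[OF assms(2) w, THEN cong_sym]
  show ?thesis by (blast intro: cong_trans)
qed

lemma additive_mod_exponent_sum: "additive_mod j (free_group B) (exponent_sum v)"
  by (simp add: additive_mod_def)

section \<open>Lifting homomorphisms from \<int>/q to \<int>\<close>

text \<open>For a finitely generated group and a prime \<open>q\<close> this expresses that the
  abelianization has no \<open>q\<close>-torsion, without forming the abelianization.\<close>

definition lifts_homs_mod :: "int \<Rightarrow> ('a, 'b) monoid_scheme \<Rightarrow> bool"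
  where "lifts_homs_mod q G \<longleftrightarrow>
    (\<forall>f. additive_mod q G f \<longrightarrow>
      (\<exists>F. additive_mod 0 G F \<and> (\<forall>x\<in>carrier G. [F x = f x] (mod q))))"

text \<open>Homomorphisms are transported along \<open>h\<close> and its inverse. Closure of
  \<open>G\<close> under multiplication is enough for this, so it applies to
  \<open>twist_ext\<close> and to McCool groups before they are shown to be groups.\<close>

lemma lifts_homs_mod_iso:
  assumes "h \<in> iso G H" and "\<And>x y. x \<in> carrier G \<Longrightarrow> y \<in> carrier G \<Longrightarrow> x \<otimes>\<^bsub>G\<^esub> y \<in> carrier G"
  shows "lifts_homs_mod q G \<longleftrightarrow> lifts_homs_mod q H"
proof -
  define k where "k = inv_into (carrier G) h"
  have bij: "bij_betw h (carrier G) (carrier H)" and h: "h \<in> hom G H"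
    using assms(1) by (auto simp: iso_def)
  have hk: "h (k y) = y" "k y \<in> carrier G" if "y \<in> carrier H" for y
    using bij that unfolding k_def by (auto simp: bij_betw_def f_inv_into_f inv_into_into)
  have kh: "k (h x) = x" if "x \<in> carrier G" for x
    using bij that unfolding k_def by (auto simp: bij_betw_def)
  have hcl: "h x \<in> carrier H" if "x \<in> carrier G" for x
    using h that by (auto simp: hom_def)
  have hm: "h (x \<otimes>\<^bsub>G\<^esub> y) = h x \<otimes>\<^bsub>H\<^esub> h y" if "x \<in> carrier G" "y \<in> carrier G" for x y
    using h that by (auto simp: hom_def)
  have km: "k (x \<otimes>\<^bsub>H\<^esub> y) = k x \<otimes>\<^bsub>G\<^esub> k y" if "x \<in> carrier H" "y \<in> carrier H" for x y
    using hm[of "k x" "k y"] hk that kh[of "k x \<otimes>\<^bsub>G\<^esub> k y"] assms(2) by simp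
  have 1: "additive_mod j G (f \<circ> h)" if "additive_mod j H f" for f j
    using that hcl hm by (auto simp: additive_mod_def)
  have 2: "additive_mod j H (f \<circ> k)" if "additive_mod j G f" for f j
    using that hk km by (auto simp: additive_mod_def)
  show ?thesis
  proof
    assume L: "lifts_homs_mod q G"
    show "lifts_homs_mod q H"
      unfolding lifts_homs_mod_def
    proof (intro allI impI)
      fix f assume "additive_mod q H f"
      from L 1[OF this] obtain F where
        "additive_mod 0 G F" "\<forall>x\<in>carrier G. [F x = f (h x)] (mod q)"
        unfolding lifts_homs_mod_def by force
      then show "\<exists>F. additive_mod 0 H F \<and> (\<forall>x\<in>carrier H. [F x = f x] (mod q))"
        using 2 hk by (intro exI[of _ "F \<circ> k"]) (metis comp_apply)
    qed
  next
    assume L: "lifts_homs_mod q H"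
    show "lifts_homs_mod q G"
      unfolding lifts_homs_mod_def
    proof (intro allI impI)
      fix f assume "additive_mod q G f"
      from L 2[OF this] obtain F where
        "additive_mod 0 H F" "\<forall>x\<in>carrier H. [F x = f (k x)] (mod q)"
        unfolding lifts_homs_mod_def by force
      then show "\<exists>F. additive_mod 0 G F \<and> (\<forall>x\<in>carrier G. [F x = f x] (mod q))"
        using 1 hcl kh by (intro exI[of _ "F \<circ> h"]) (metis comp_apply)
    qed
  qed
qed


section \<open>Automorphisms conjugating a basis element\<close>

text \<open>Each letter over \<open>t\<close> is replaced by its conjugate by \<open>p\<close>.
  These blocks begin and end with letters over \<open>t\<close>, so letters from \<open>A\<close>
  never cancel against them, and adjacent blocks merge without losing their central letters. An
  image beginning with a block is longer than one letter, and any other nonempty image begins with a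
  letter from \<open>A\<close>.\<close>

lemma conj_hom_omits_gen:
  assumes t: "t \<notin> A"
    and p: "p \<in> carrier (free_group (insert t A))" "p \<noteq> []" "fst (hd p) = t" "fst (last p) \<noteq> t"
    and \<psi>: "\<psi> \<in> hom (free_group (insert t A)) (free_group (insert t A))"
    and \<psi>A: "\<And>x. x \<in> A \<Longrightarrow> \<psi> (gen x) = gen x"
    and \<psi>t: "\<psi> (gen t) = p \<otimes>\<^bsub>free_group (insert t A)\<^esub> gen t \<otimes>\<^bsub>free_group (insert t A)\<^esub> inv\<^bsub>free_group (insert t A)\<^esub> p"
    and x: "x \<in> carrier (free_group (insert t A))"
  shows "\<psi> x \<noteq> gen t"
proof -
  let ?F = "free_group (insert t A)"
  interpret F: group ?F by (rule group_free_group)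
  interpret \<psi>: group_hom ?F ?F \<psi> using \<psi> by unfold_locales
  have inv_gen: "inv\<^bsub>?F\<^esub> (gen y) = [(y, False)]" if "y \<in> insert t A" for y
    using that by (subst inv_free_group) (auto simp: letter_inv_def)
  have letter: "[a] \<in> carrier ?F" if "fst a \<in> insert t A" for a
    using that by (simp add: carrier_free_group reduced_Cons)
  have \<psi>a: "\<psi> [a] = [a]" if "fst a \<in> A" for a
  proof (cases "snd a")
    case True
    then show ?thesis using \<psi>A[OF that] by (metis prod.collapse)
  next
    case False
    then have "[a] = inv\<^bsub>?F\<^esub> (gen (fst a))" using inv_gen[of "fst a"] that by (metis insertCI prod.collapse)
    then show ?thesis using \<psi>A[OF that] letter[of "(fst a, True)"] that by simp
  qed
  have \<psi>te: "\<psi> [(t, e)] = p \<otimes>\<^bsub>?F\<^esub> [(t, e)] \<otimes>\<^bsub>?F\<^esub> inv\<^bsub>?F\<^esub> p" for e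
  proof (cases e)
    case False
    have T: "gen t \<in> carrier ?F" by simp
    have "\<psi> [(t, e)] = inv\<^bsub>?F\<^esub> (\<psi> (gen t))" using inv_gen[of t] False T by (simp flip: \<psi>.hom_inv)
    also have "\<dots> = p \<otimes>\<^bsub>?F\<^esub> inv\<^bsub>?F\<^esub> (gen t) \<otimes>\<^bsub>?F\<^esub> inv\<^bsub>?F\<^esub> p"
      unfolding \<psi>t using p(1) T by (simp add: F.inv_mult_group F.m_assoc del: gen_in_carrier)
    finally show ?thesis using inv_gen[of t] False by simp
  qed (simp add: \<psi>t)
  \<comment> \<open>The last letter of \<open>p\<close> is not over \<open>t\<close>, so the
    conjugate is already reduced.\<close>
  have \<psi>te': "\<psi> [(t, e)] = p @ (t, e) # word_inv p" for e
  proof -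
    have red: "reduced (p @ (t, e) # word_inv p)"
      using p by (auto simp: carrier_free_group reduced_append reduced_Cons hd_word_inv
          dest!: arg_cong[of _ _ fst])
    have "p \<otimes>\<^bsub>?F\<^esub> [(t, e)] = p @ [(t, e)]"
      using red by (intro mult_eq_append) (auto simp: reduced_append reduced_Cons)
    then show ?thesis
      using red mult_eq_append[of "p @ [(t, e)]" "word_inv p"] by (simp add: \<psi>te inv_free_group p(1))
  qed
  have step: "\<psi> (a # w) = \<psi> [a] \<otimes>\<^bsub>?F\<^esub> \<psi> w" if "a # w \<in> carrier ?F" for a w
  proof -
    have "a # w = [a] \<otimes>\<^bsub>?F\<^esub> w"
      using that by (subst mult_eq_append) (auto simp: carrier_free_group)
    moreover have "[a] \<in> carrier ?F" "w \<in> carrier ?F"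
      using that by (auto simp: carrier_free_group reduced_Cons)
    ultimately show ?thesis using \<psi>.hom_mult by simp
  qed
  \<comment> \<open>The invariant tracks only the beginning of the image: it is the letter itself
    for a letter from \<open>A\<close>, and \<open>p\<close> followed by the letter for a letter
    over \<open>t\<close>.\<close>
  have main: "(x = [] \<longrightarrow> \<psi> x = []) \<and>
      (x \<noteq> [] \<and> fst (hd x) \<noteq> t \<longrightarrow> \<psi> x = hd x # \<psi> (tl x)) \<and>
      (x \<noteq> [] \<and> fst (hd x) = t \<longrightarrow> (\<exists>y. \<psi> x = p @ hd x # y))"
    using x
  proof (induction x)
    case Nil
    then show ?case using \<psi>.hom_one by (simp add: one_free_group)
  next
    case (Cons a w)
    have w: "w \<in> carrier ?F" and a: "fst a \<in> insert t A"
      and aw: "w \<noteq> [] \<Longrightarrow> hd w \<noteq> letter_inv a"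
      using Cons.prems by (auto simp: carrier_free_group reduced_Cons)
    note IH = Cons.IH[OF w]
    have red: "reduced (\<psi> w)"
      using \<psi>.hom_closed[OF w] by (simp add: carrier_free_group)
    show ?case
    proof (cases "fst a = t")
      case False
      have "reduced ([a] @ \<psi> w)"
        using red IH aw False p by (cases "w = []"; cases "fst (hd w) = t")
          (auto simp: reduced_Cons dest!: arg_cong[of _ _ fst])
      then have "\<psi> (a # w) = [a] @ \<psi> w"
        using step[OF Cons.prems] \<psi>a a False by (simp add: mult_eq_append)
      then show ?thesis using False by simp
    next
      case True
      then obtain e where a: "a = (t, e)" by (cases a) auto
      have \<psi>aw: "\<psi> (a # w) = (p @ a # word_inv p) \<otimes>\<^bsub>?F\<^esub> \<psi> w"
        using step[OF Cons.prems] \<psi>te' a by simp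
      have ra: "reduced (p @ a # word_inv p)"
        using \<psi>.hom_closed[OF letter[of a]] \<psi>te'[of e] a by (simp add: carrier_free_group)
      have "\<exists>y. \<psi> (a # w) = p @ a # y"
      proof (cases "w \<noteq> [] \<and> fst (hd w) = t")
        case False
        then have "reduced ((p @ a # word_inv p) @ \<psi> w)"
          using ra red IH p by (subst reduced_append)
            (auto simp: last_word_inv dest!: arg_cong[of _ _ fst])
        then show ?thesis unfolding \<psi>aw by (subst mult_eq_append) auto
      next
        case True
        \<comment> \<open>Two successive letters over \<open>t\<close> have the same sign by
          reducedness. The inverse of \<open>p\<close> cancels against the next \<open>p\<close>,
          and the two central letters become neighbours.\<close>
        with IH obtain y where y: "\<psi> w = p @ hd w # y" by auto
        have hdw: "hd w = a"
          using True aw a by (cases "hd w") (auto simp: letter_inv_def)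
        have ay: "a # y \<in> carrier ?F"
          using \<psi>.hom_closed[OF w] by (auto simp: y hdw carrier_free_group reduced_append)
        have A: "[a] \<in> carrier ?F" using a by (simp add: letter)
        have py: "\<psi> w = p \<otimes>\<^bsub>?F\<^esub> (a # y)"
          using red by (subst mult_eq_append) (auto simp: y hdw)
        have "\<psi> (a # w) = p \<otimes>\<^bsub>?F\<^esub> [a] \<otimes>\<^bsub>?F\<^esub> inv\<^bsub>?F\<^esub> p \<otimes>\<^bsub>?F\<^esub> (p \<otimes>\<^bsub>?F\<^esub> (a # y))"
          using step[OF Cons.prems] \<psi>te a py by simp
        also have "\<dots> = p \<otimes>\<^bsub>?F\<^esub> ([a] \<otimes>\<^bsub>?F\<^esub> (inv\<^bsub>?F\<^esub> p \<otimes>\<^bsub>?F\<^esub> p \<otimes>\<^bsub>?F\<^esub> (a # y)))"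
          using p(1) A ay by (simp only: F.m_assoc F.m_closed F.inv_closed)
        also have "\<dots> = p \<otimes>\<^bsub>?F\<^esub> ([a] \<otimes>\<^bsub>?F\<^esub> (a # y))"
          using p(1) ay by simp
        also have "[a] \<otimes>\<^bsub>?F\<^esub> (a # y) = a # a # y"
          using ay by (subst mult_eq_append) (auto simp: carrier_free_group reduced_Cons)
        also have "p \<otimes>\<^bsub>?F\<^esub> (a # a # y) = p @ a # a # y"
          using ay red by (intro mult_eq_append)
            (auto simp: y hdw carrier_free_group reduced_append reduced_Cons)
        finally show ?thesis by blast
      qed
      then show ?thesis using True by simp
    qed
  qed
  show ?thesis
  proof
    assume "\<psi> x = gen t"
    then have "x \<noteq> []" using main by auto
    show False
    proof (cases "fst (hd x) = t")
      case True
      with main \<open>x \<noteq> []\<close> obtain y where "gen t = p @ hd x # y"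
        using \<open>\<psi> x = gen t\<close> by auto
      from arg_cong[OF this, of length] p(2) show False by simp
    next
      case False
      then have "hd x # \<psi> (tl x) = gen t" using main \<open>x \<noteq> []\<close> \<open>\<psi> x = gen t\<close> by simp
      then have "hd x = (t, True)" by simp
      with False show False by simp
    qed
  qed
qed

text \<open>A shortest conjugator is split at its first letter over \<open>t\<close>. If a nonempty
  part \<open>p\<close> remained, the image of \<open>\<phi>\<close> would lie in the image of the
  map that fixes \<open>A\<close> and conjugates \<open>t\<close> by \<open>p\<close>, and this
  image omits \<open>t\<close>.\<close>

lemma conj_gen_in_factor:
  assumes t: "t \<notin> A"
    and \<phi>: "\<phi> \<in> hom (free_group (insert t A)) (free_group (insert t A))"
    and surj: "gen t \<in> \<phi> ` carrier (free_group (insert t A))"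
    and \<phi>A: "\<And>x. x \<in> A \<Longrightarrow> \<phi> (gen x) \<in> carrier (free_group A)"
    and g: "g \<in> carrier (free_group (insert t A))"
    and \<phi>t: "\<phi> (gen t) = g \<otimes>\<^bsub>free_group (insert t A)\<^esub> gen t \<otimes>\<^bsub>free_group (insert t A)\<^esub> inv\<^bsub>free_group (insert t A)\<^esub> g"
  shows "\<exists>g\<in>carrier (free_group A).
    \<phi> (gen t) = g \<otimes>\<^bsub>free_group (insert t A)\<^esub> gen t \<otimes>\<^bsub>free_group (insert t A)\<^esub> inv\<^bsub>free_group (insert t A)\<^esub> g"
proof -
  let ?F = "free_group (insert t A)"
  interpret F: group ?F by (rule group_free_group)
  interpret \<phi>: group_hom ?F ?F \<phi> using \<phi> by unfold_locales
  let ?P = "\<lambda>g. g \<in> carrier ?F \<and> \<phi> (gen t) = g \<otimes>\<^bsub>?F\<^esub> gen t \<otimes>\<^bsub>?F\<^esub> inv\<^bsub>?F\<^esub> g"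
  have T: "gen t \<in> carrier ?F" by simp
  \<comment> \<open>Powers of \<open>t\<close> at the end of the conjugator commute with
    \<open>t\<close>; minimal length excludes them.\<close>
  obtain k where k: "k \<in> carrier ?F" "\<phi> (gen t) = k \<otimes>\<^bsub>?F\<^esub> gen t \<otimes>\<^bsub>?F\<^esub> inv\<^bsub>?F\<^esub> k"
    and min: "\<And>g. ?P g \<Longrightarrow> length k \<le> length g"
    using ex_has_least_nat[of ?P g length] g \<phi>t by blast
  have last: "fst (last k) \<noteq> t" if "k \<noteq> []"
  proof
    assume "fst (last k) = t"
    then obtain k' e where k': "k = k' @ [(t, e)]"
      using \<open>k \<noteq> []\<close> by (metis append_butlast_last_id prod.collapse)
    have K': "k' \<in> carrier ?F" and E: "[(t, e)] \<in> carrier ?F"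
      using k(1) by (auto simp: k' carrier_free_group reduced_append)
    have keq: "k = k' \<otimes>\<^bsub>?F\<^esub> [(t, e)]"
      using k(1) by (subst mult_eq_append) (auto simp: k' carrier_free_group)
    have "[(t, e)] = gen t \<or> [(t, e)] = inv\<^bsub>?F\<^esub> (gen t)"
      by (cases e) (auto simp: inv_free_group letter_inv_def)
    then have conj_t: "[(t, e)] \<otimes>\<^bsub>?F\<^esub> gen t \<otimes>\<^bsub>?F\<^esub> inv\<^bsub>?F\<^esub> [(t, e)] = gen t"
      using T by (elim disjE) (simp_all add: F.m_assoc del: gen_in_carrier)
    then have "k \<otimes>\<^bsub>?F\<^esub> gen t \<otimes>\<^bsub>?F\<^esub> inv\<^bsub>?F\<^esub> k = k' \<otimes>\<^bsub>?F\<^esub> gen t \<otimes>\<^bsub>?F\<^esub> inv\<^bsub>?F\<^esub> k'"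
    proof -
      have "k \<otimes>\<^bsub>?F\<^esub> gen t \<otimes>\<^bsub>?F\<^esub> inv\<^bsub>?F\<^esub> k =
          k' \<otimes>\<^bsub>?F\<^esub> ([(t, e)] \<otimes>\<^bsub>?F\<^esub> gen t \<otimes>\<^bsub>?F\<^esub> inv\<^bsub>?F\<^esub> [(t, e)]) \<otimes>\<^bsub>?F\<^esub> inv\<^bsub>?F\<^esub> k'"
        unfolding keq using K' E T by (simp add: F.inv_mult_group F.m_assoc del: gen_in_carrier)
      also have "\<dots> = k' \<otimes>\<^bsub>?F\<^esub> gen t \<otimes>\<^bsub>?F\<^esub> inv\<^bsub>?F\<^esub> k'" by (simp only: conj_t)
      finally show ?thesis .
    qed
    then have "?P k'" using k K' by simp
    from min[OF this] show False by (simp add: k')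
  qed
  define \<alpha> where "\<alpha> = takeWhile (\<lambda>a. fst a \<noteq> t) k"
  define p where "p = dropWhile (\<lambda>a. fst a \<noteq> t) k"
  have split: "k = \<alpha> @ p" by (simp add: \<alpha>_def p_def)
  have \<alpha>: "\<alpha> \<in> carrier (free_group A)"
  proof -
    have "fst ` set \<alpha> \<subseteq> insert t A" "reduced \<alpha>"
      using k(1) by (auto simp: split carrier_free_group reduced_append)
    moreover have "t \<notin> fst ` set \<alpha>"
      by (auto simp: \<alpha>_def dest: set_takeWhileD)
    ultimately show ?thesis by (auto simp: carrier_free_group)
  qed
  have sub: "x \<in> carrier ?F" if "x \<in> carrier (free_group A)" for x
    using that by (rule free_group_mono[rotated]) auto
  show ?thesis
  proof (cases "p = []")
    case True
    then show ?thesis using \<alpha> k split by auto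
  next
    case False
    have p: "p \<in> carrier ?F" "fst (last p) \<noteq> t"
      using k(1) False last by (auto simp: split carrier_free_group reduced_append)
    have hdp: "fst (hd p) = t"
      using hd_dropWhile[of "\<lambda>a. fst a \<noteq> t" k] False
      by (metis (mono_tags, lifting) dropWhile_eq_Nil_conv p_def)
    have keq: "k = \<alpha> \<otimes>\<^bsub>?F\<^esub> p"
      using k(1) by (subst mult_eq_append) (auto simp: split carrier_free_group)
    \<comment> \<open>The factor \<open>\<alpha>\<close> is left out of this map: it lies in
      \<open>A\<close>, which \<open>\<psi>\<close> fixes, so conjugation by \<open>\<alpha>\<close>
      can be performed before applying \<open>\<psi>\<close>.\<close>
    define f where "f x = (if x = t then p \<otimes>\<^bsub>?F\<^esub> gen t \<otimes>\<^bsub>?F\<^esub> inv\<^bsub>?F\<^esub> p else gen x)" for x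
    have f: "f \<in> insert t A \<rightarrow> carrier ?F" using p T by (auto simp: f_def)
    define \<psi> where "\<psi> = lift ?F (insert t A) f"
    have \<psi>: "\<psi> \<in> hom ?F ?F" unfolding \<psi>_def by (rule lift_hom[OF group_free_group f])
    have \<psi>f: "\<psi> (gen x) = f x" if "x \<in> insert t A" for x
      unfolding \<psi>_def by (rule lift_gen[OF group_free_group f that])
    interpret \<psi>: group_hom ?F ?F \<psi> using \<psi> by unfold_locales
    have \<psi>A: "\<psi> x = x" if "x \<in> carrier (free_group A)" for x
    proof (rule hom_free_group_eqI[of ?F _ A "\<lambda>x. x"])
      show "\<psi> \<in> hom (free_group A) ?F" using \<psi> sub by (auto simp: hom_def mult_free_group)
      show "(\<lambda>x. x) \<in> hom (free_group A) ?F" using sub by (auto simp: hom_def mult_free_group)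
      show "\<psi> (gen x) = gen x" if "x \<in> A" for x using \<psi>f[of x] that t by (auto simp: f_def)
    qed (use that group_free_group in auto)
    have inA: "\<phi> (gen x) \<in> \<psi> ` carrier ?F" if "x \<in> insert t A" for x
    proof (cases "x = t")
      case True
      have "\<phi> (gen t) = \<alpha> \<otimes>\<^bsub>?F\<^esub> (p \<otimes>\<^bsub>?F\<^esub> gen t \<otimes>\<^bsub>?F\<^esub> inv\<^bsub>?F\<^esub> p) \<otimes>\<^bsub>?F\<^esub> inv\<^bsub>?F\<^esub> \<alpha>"
        unfolding k(2) keq using p(1) T sub[OF \<alpha>] by (simp add: F.m_assoc F.inv_mult_group)
      also have "\<dots> = \<psi> \<alpha> \<otimes>\<^bsub>?F\<^esub> \<psi> (gen t) \<otimes>\<^bsub>?F\<^esub> inv\<^bsub>?F\<^esub> (\<psi> \<alpha>)"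
        using \<psi>A[OF \<alpha>] \<psi>f[of t] by (simp add: f_def)
      also have "\<dots> = \<psi> (\<alpha> \<otimes>\<^bsub>?F\<^esub> gen t \<otimes>\<^bsub>?F\<^esub> inv\<^bsub>?F\<^esub> \<alpha>)"
        using sub[OF \<alpha>] T by (simp del: gen_in_carrier)
      finally show ?thesis
        unfolding True
        by (rule image_eqI) (intro F.m_closed F.inv_closed sub[OF \<alpha>] T)
    next
      case False
      then have "\<phi> (gen x) \<in> carrier (free_group A)" using that \<phi>A by auto
      from \<psi>A[OF this] sub[OF this] show ?thesis by (metis imageI)
    qed
    interpret S: subgroup "\<psi> ` carrier ?F" ?F by (rule \<psi>.img_is_subgroup)
    have "\<phi> x \<in> \<psi> ` carrier ?F" if "x \<in> carrier ?F" for x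
      using that
    proof (induction rule: free_group_induct)
      case one
      then show ?case using \<phi>.hom_one S.one_closed by (simp add: one_free_group)
    next
      case (gen x w)
      have "gen x \<in> carrier ?F" using gen by simp
      then show ?case using inA[OF gen(1)] gen by (simp del: gen_in_carrier)
    next
      case (inv x w)
      have "gen x \<in> carrier ?F" using inv by simp
      then show ?case using inA[OF inv(1)] inv by (simp del: gen_in_carrier)
    qed
    with surj have "gen t \<in> \<psi> ` carrier ?F" by auto
    moreover have "\<psi> x \<noteq> gen t" if "x \<in> carrier ?F" for x
      by (rule conj_hom_omits_gen[OF t p(1) False hdp p(2) \<psi> _ _ that])
        (use \<psi>f t in \<open>auto simp: f_def\<close>)
    ultimately show ?thesis by fastforce
  qed
qed

section \<open>Outer automorphisms\<close>

definition outer :: "('a, 'b) monoid_scheme \<Rightarrow> ('a \<Rightarrow> 'a) \<Rightarrow> ('a \<Rightarrow> 'a) set"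
  where "outer G \<phi> = Inn G #>\<^bsub>AutoGroup G\<^esub> \<phi>"

lemma autoD:
  assumes "\<phi> \<in> auto G"
  shows "\<phi> \<in> hom G G" "bij_betw \<phi> (carrier G) (carrier G)" "\<phi> \<in> extensional (carrier G)"
    "x \<in> carrier G \<Longrightarrow> \<phi> x \<in> carrier G"
  using assms by (auto simp: auto_def Bij_def hom_def)

context group
begin

lemma inner_aut_auto: "g \<in> carrier G \<Longrightarrow> inner_aut G g \<in> auto G"
  using inner_aut_hom by (auto simp: hom_def AutoGroup_simps)

lemma outer_hom: "outer G \<in> hom (AutoGroup G) (Out G)"
  unfolding outer_def Out_def using normal.r_coset_hom_Mod[OF normal_Inn] .

lemma carrier_Out: "carrier (Out G) = outer G ` auto G"
  by (auto simp: Out_def FactGroup_def RCOSETS_def outer_def AutoGroup_simps)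

lemma mem_outer_iff:
  assumes "\<phi> \<in> auto G" "\<psi> \<in> auto G"
  shows "\<psi> \<in> outer G \<phi> \<longleftrightarrow>
    (\<exists>g\<in>carrier G. \<forall>x\<in>carrier G. \<psi> x = g \<otimes> \<phi> x \<otimes> inv g)"
proof -
  have *: "\<psi> = inner_aut G g \<otimes>\<^bsub>AutoGroup G\<^esub> \<phi> \<longleftrightarrow>
      (\<forall>x\<in>carrier G. \<psi> x = g \<otimes> \<phi> x \<otimes> inv g)" if "g \<in> carrier G" for g
  proof -
    have "(\<psi> = compose (carrier G) (inner_aut G g) \<phi>) \<longleftrightarrow>
        (\<forall>x\<in>carrier G. \<psi> x = g \<otimes> \<phi> x \<otimes> inv g)"
      using autoD(3,4)[OF assms(1)] autoD(3)[OF assms(2)]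
      by (auto simp: compose_def inner_aut_def fun_eq_iff extensional_def)
    then show ?thesis using assms that by (simp add: AutoGroup_simps inner_aut_auto)
  qed
  show ?thesis
    using * by (auto simp: outer_def r_coset_def Inn_def)
qed

lemma outer_subset_auto: "\<phi> \<in> auto G \<Longrightarrow> outer G \<phi> \<subseteq> auto G"
proof -
  interpret A: group "AutoGroup G" by (rule AutoGroup)
  assume "\<phi> \<in> auto G"
  moreover have "Inn G \<subseteq> auto G" by (auto simp: Inn_def inner_aut_auto)
  ultimately show ?thesis
    unfolding outer_def AutoGroup_simps(1)[symmetric] by (intro A.r_coset_subset_G)
qed

lemma self_mem_outer: "\<phi> \<in> auto G \<Longrightarrow> \<phi> \<in> outer G \<phi>"
  by (subst mem_outer_iff) (auto intro!: bexI[of _ \<one>] dest: autoD(4))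

lemma outer_eq_iff:
  assumes "\<phi> \<in> auto G" "\<psi> \<in> auto G"
  shows "outer G \<psi> = outer G \<phi> \<longleftrightarrow>
    (\<exists>g\<in>carrier G. \<forall>x\<in>carrier G. \<psi> x = g \<otimes> \<phi> x \<otimes> inv g)"
proof -
  interpret A: group "AutoGroup G" by (rule AutoGroup)
  have "outer G \<psi> = outer G \<phi> \<longleftrightarrow> \<psi> \<in> outer G \<phi>"
    using A.repr_independence[of \<psi> "Inn G" \<phi>] self_mem_outer[OF assms(2)] assms
      normal_imp_subgroup[OF normal_Inn]
    by (auto simp: outer_def AutoGroup_simps)
  then show ?thesis using mem_outer_iff[OF assms] by simp
qed

text \<open>Composing with an inner automorphism makes a representative the identity on a chosen
  member of the family.\<close>

lemma Mc_eq_fixing: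
  assumes H0: "H0 \<in> \<H>" and sub: "\<And>H. H \<in> \<H> \<Longrightarrow> H \<subseteq> carrier G"
  shows "Mc G \<H> = outer G ` {\<phi> \<in> auto G. (\<forall>h\<in>H0. \<phi> h = h) \<and> acts_trivially_on G \<H> \<phi>}"
proof (intro equalityI subsetI)
  fix \<Phi> assume "\<Phi> \<in> Mc G \<H>"
  then obtain \<phi> where \<phi>: "\<phi> \<in> \<Phi>" "acts_trivially_on G \<H> \<phi>" and "\<Phi> \<in> carrier (Out G)"
    by (auto simp: Mc_def)
  then obtain \<psi> where \<psi>: "\<psi> \<in> auto G" "\<Phi> = outer G \<psi>"
    by (auto simp: carrier_Out)
  have \<phi>a: "\<phi> \<in> auto G" using outer_subset_auto \<psi> \<phi>(1) by auto
  have "outer G \<phi> = outer G \<psi>"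
    using mem_outer_iff[OF \<psi>(1) \<phi>a] outer_eq_iff[OF \<psi>(1) \<phi>a] \<phi>(1) \<psi>(2) by (simp only:)
  with \<psi>(2) have \<Phi>: "\<Phi> = outer G \<phi>" by simp
  obtain g where g: "g \<in> carrier G" "\<And>h. h \<in> H0 \<Longrightarrow> \<phi> h = g \<otimes> h \<otimes> inv g"
    using \<phi>(2) H0 unfolding acts_trivially_on_def by blast
  define \<phi>' where "\<phi>' = inner_aut G (inv g) \<otimes>\<^bsub>AutoGroup G\<^esub> \<phi>"
  interpret A: group "AutoGroup G" by (rule AutoGroup)
  have \<phi>'a: "\<phi>' \<in> auto G"
    using A.m_closed[of "inner_aut G (inv g)" \<phi>] inner_aut_auto[of "inv g"] \<phi>a g(1)
    by (simp add: \<phi>'_def AutoGroup_simps(1))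
  have "\<phi>' = compose (carrier G) (inner_aut G (inv g)) \<phi>"
    unfolding \<phi>'_def using \<phi>a g(1) by (intro AutoGroup_simps(3) inner_aut_auto) auto
  then have \<phi>'x: "\<phi>' x = inv g \<otimes> \<phi> x \<otimes> g" if "x \<in> carrier G" for x
    using that g(1) autoD(4)[OF \<phi>a that] by (simp add: compose_def inner_aut_def)
  have conj: "inv g \<otimes> (k \<otimes> h \<otimes> inv k) \<otimes> g = (inv g \<otimes> k) \<otimes> h \<otimes> inv (inv g \<otimes> k)"
    if "k \<in> carrier G" "h \<in> carrier G" for k h
    using that g(1) by (simp add: inv_mult_group m_assoc)
  have "outer G \<phi>' = outer G \<phi>"
    unfolding outer_eq_iff[OF \<phi>a \<phi>'a] using g(1) \<phi>'x by (intro bexI[of _ "inv g"]) auto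
  moreover have "\<forall>h\<in>H0. \<phi>' h = h"
  proof
    fix h assume h: "h \<in> H0"
    then have "h \<in> carrier G" using sub[OF H0] by auto
    then show "\<phi>' h = h" using \<phi>'x conj[OF g(1)] g h by simp
  qed
  moreover have "acts_trivially_on G \<H> \<phi>'"
    unfolding acts_trivially_on_def
  proof
    fix H assume H: "H \<in> \<H>"
    then obtain k where k: "k \<in> carrier G" "\<And>h. h \<in> H \<Longrightarrow> \<phi> h = k \<otimes> h \<otimes> inv k"
      using \<phi>(2) unfolding acts_trivially_on_def by blast
    show "\<exists>k\<in>carrier G. \<forall>h\<in>H. \<phi>' h = k \<otimes> h \<otimes> inv k"
    proof (intro bexI ballI)
      fix h assume "h \<in> H"
      then show "\<phi>' h = (inv g \<otimes> k) \<otimes> h \<otimes> inv (inv g \<otimes> k)"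
        using \<phi>'x[of h] k conj[OF k(1), of h] sub[OF H] by auto
    qed (use g k in auto)
  qed
  ultimately show "\<Phi> \<in> outer G ` {\<phi> \<in> auto G. (\<forall>h\<in>H0. \<phi> h = h) \<and> acts_trivially_on G \<H> \<phi>}"
    using \<phi>'a \<Phi> by blast
next
  fix \<Phi> assume "\<Phi> \<in> outer G ` {\<phi> \<in> auto G. (\<forall>h\<in>H0. \<phi> h = h) \<and> acts_trivially_on G \<H> \<phi>}"
  then show "\<Phi> \<in> Mc G \<H>"
    using self_mem_outer by (auto simp: Mc_def carrier_Out)
qed

end

section \<open>The action on homology modulo j\<close>

text \<open>For prime \<open>j\<close> this is trivial action on the abelianization modulo
  \<open>j\<close>, tested through homomorphisms to \<int>/j.\<close>

definition homology_trivial :: "int \<Rightarrow> ('a, 'b) monoid_scheme \<Rightarrow> ('a \<Rightarrow> 'a) \<Rightarrow> bool"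
  where "homology_trivial j G \<phi> \<longleftrightarrow>
    (\<forall>f. additive_mod j G f \<longrightarrow> (\<forall>x\<in>carrier G. [f (\<phi> x) = f x] (mod j)))"

definition outer_homology_trivial :: "int \<Rightarrow> ('a, 'b) monoid_scheme \<Rightarrow> ('a \<Rightarrow> 'a) set set \<Rightarrow> bool"
  where "outer_homology_trivial j G M \<longleftrightarrow>
    (\<forall>\<phi>\<in>auto G. outer G \<phi> \<in> M \<longrightarrow> homology_trivial j G \<phi>)"

context group
begin

text \<open>Representatives differ by a conjugation, which no homomorphism to an abelian group
  sees.\<close>

lemma homology_trivial_outer_cong:
  assumes "\<phi> \<in> auto G" "\<psi> \<in> auto G" "outer G \<psi> = outer G \<phi>" "homology_trivial j G \<phi>"
  shows "homology_trivial j G \<psi>"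
  unfolding homology_trivial_def
proof (intro allI impI ballI)
  fix f x assume f: "additive_mod j G f" and x: "x \<in> carrier G"
  obtain g where g: "g \<in> carrier G" "\<psi> x = g \<otimes> \<phi> x \<otimes> inv g"
    using outer_eq_iff[OF assms(1,2)] assms(3) x by blast
  have \<phi>x: "\<phi> x \<in> carrier G" using autoD(4)[OF assms(1) x] .
  have "[f (\<psi> x) = f (g \<otimes> \<phi> x) + f (inv g)] (mod j)"
    unfolding g(2) by (rule additive_modD[OF f]) (use g \<phi>x in auto)
  also have "[f (g \<otimes> \<phi> x) + f (inv g) = (f g + f (\<phi> x)) + - f g] (mod j)"
    by (intro cong_add additive_modD[OF f] additive_mod_inv[OF is_group f]) (use g \<phi>x in auto)
  also have "(f g + f (\<phi> x)) + - f g = f (\<phi> x)" by simp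
  also have "[f (\<phi> x) = f x] (mod j)"
    using assms(4) f x by (auto simp: homology_trivial_def)
  finally show "[f (\<psi> x) = f x] (mod j)" .
qed

lemma outer_homology_trivial_image:
  assumes "K \<subseteq> auto G"
  shows "outer_homology_trivial j G (outer G ` K) \<longleftrightarrow> (\<forall>\<phi>\<in>K. homology_trivial j G \<phi>)"
proof
  assume "outer_homology_trivial j G (outer G ` K)"
  then show "\<forall>\<phi>\<in>K. homology_trivial j G \<phi>"
    using assms by (auto simp: outer_homology_trivial_def)
next
  assume triv: "\<forall>\<phi>\<in>K. homology_trivial j G \<phi>"
  show "outer_homology_trivial j G (outer G ` K)"
    unfolding outer_homology_trivial_def
  proof (intro ballI impI)
    fix \<psi> assume \<psi>: "\<psi> \<in> auto G" and "outer G \<psi> \<in> outer G ` K"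
    then obtain \<phi> where \<phi>: "\<phi> \<in> K" "outer G \<psi> = outer G \<phi>" by blast
    show "homology_trivial j G \<psi>"
      by (rule homology_trivial_outer_cong[OF _ \<psi> \<phi>(2)]) (use \<phi>(1) assms triv in auto)
  qed
qed

text \<open>Acting trivially on homology is preserved by conjugation, because precomposing a
  homomorphism to \<int>/j with an automorphism gives another one.\<close>

lemma outer_homology_trivial_conjugate:
  assumes "conjugate_subgroups (Out G) M N" "M \<subseteq> carrier (Out G)" "outer_homology_trivial j G M"
  shows "outer_homology_trivial j G N"
  unfolding outer_homology_trivial_def
proof (intro ballI impI)
  interpret A: group "AutoGroup G" by (rule AutoGroup)
  interpret O: group "Out G" by (rule group_Out)
  interpret o: group_hom "AutoGroup G" "Out G" "outer G"
    using outer_hom by unfold_locales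
  fix \<phi> assume \<phi>: "\<phi> \<in> auto G" and "outer G \<phi> \<in> N"
  moreover obtain \<psi> where \<psi>: "\<psi> \<in> auto G"
    and "N = outer G \<psi> <#\<^bsub>Out G\<^esub> M #>\<^bsub>Out G\<^esub> inv\<^bsub>Out G\<^esub> (outer G \<psi>)"
    using assms(1) by (auto simp: conjugate_subgroups_def carrier_Out)
  ultimately obtain m where "m \<in> M" and
    \<phi>m: "outer G \<phi> = outer G \<psi> \<otimes>\<^bsub>Out G\<^esub> m \<otimes>\<^bsub>Out G\<^esub> inv\<^bsub>Out G\<^esub> (outer G \<psi>)"
    by (auto simp: l_coset_def r_coset_def)
  then obtain \<mu> where \<mu>: "\<mu> \<in> auto G" "m = outer G \<mu>"
    using assms(2) by (auto simp: carrier_Out)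
  then have triv: "homology_trivial j G \<mu>"
    using assms(3) \<open>m \<in> M\<close> by (auto simp: outer_homology_trivial_def)
  let ?i = "inv\<^bsub>AutoGroup G\<^esub> \<psi>"
  define \<chi> where "\<chi> = \<psi> \<otimes>\<^bsub>AutoGroup G\<^esub> \<mu> \<otimes>\<^bsub>AutoGroup G\<^esub> ?i"
  note c = AutoGroup_simps(1)[of G, symmetric]
  have i: "?i \<in> auto G" using A.inv_closed \<psi> by (simp add: c)
  have \<psi>\<mu>: "\<psi> \<otimes>\<^bsub>AutoGroup G\<^esub> \<mu> \<in> auto G" using A.m_closed \<psi> \<mu> by (simp add: c)
  have \<chi>: "\<chi> \<in> auto G" using A.m_closed \<psi>\<mu> i by (simp add: \<chi>_def c)
  have "outer G \<phi> = outer G \<chi>"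
    using \<phi>m \<psi> \<mu> i \<psi>\<mu> by (simp add: \<chi>_def c)
  moreover have "homology_trivial j G \<chi>"
    unfolding homology_trivial_def
  proof (intro allI impI ballI)
    fix f x assume f: "additive_mod j G f" and x: "x \<in> carrier G"
    have "\<psi> \<otimes>\<^bsub>AutoGroup G\<^esub> ?i = \<one>\<^bsub>AutoGroup G\<^esub>"
      using \<psi> by (simp add: c)
    from fun_cong[OF this, of x] have inv: "\<psi> (?i x) = x"
      using \<psi> i x by (simp add: AutoGroup_simps compose_def)
    \<comment> \<open>Triviality of \<open>\<mu>\<close> is applied to this pulled-back homomorphism
      at the preimage of \<open>x\<close> under \<open>\<psi>\<close>.\<close>
    have "additive_mod j G (\<lambda>y. f (\<psi> y))"
      using f autoD(1,4)[OF \<psi>] by (auto simp: additive_mod_def hom_def)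
    then have "[f (\<psi> (\<mu> (?i x))) = f (\<psi> (?i x))] (mod j)"
      using triv autoD(4)[OF i x] by (auto simp: homology_trivial_def)
    moreover have "\<chi> x = \<psi> (\<mu> (?i x))"
      using \<psi> \<mu> i \<psi>\<mu> x autoD(4)[OF i x] by (simp add: \<chi>_def AutoGroup_simps compose_def)
    ultimately show "[f (\<chi> x) = f x] (mod j)" using inv by simp
  qed
  ultimately show "homology_trivial j G \<phi>"
    using homology_trivial_outer_cong[OF \<chi> \<phi>] by simp
qed

end

section \<open>Twist automorphisms\<close>

lemma hom_free_group_subset:
  assumes "\<phi> \<in> hom (free_group C) G" "B \<subseteq> C"
  shows "\<phi> \<in> hom (free_group B) G"
proof (rule homI)
  fix x y assume "x \<in> carrier (free_group B)" "y \<in> carrier (free_group B)"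
  then have "x \<in> carrier (free_group C)" "y \<in> carrier (free_group C)"
    using free_group_mono[OF assms(2)] by auto
  then show "\<phi> x \<in> carrier G" "\<phi> (x \<otimes>\<^bsub>free_group B\<^esub> y) = \<phi> x \<otimes>\<^bsub>G\<^esub> \<phi> y"
    using hom_in_carrier[OF assms(1)] hom_mult[OF assms(1)] by (simp_all add: mult_free_group)
qed

text \<open>
  In the locale below the generators \<open>0, \<dots>, r - 1\<close> are pinned, \<open>r\<close> is multiplied by powers of
  \<open>hword p\<close>, and \<open>Suc r\<close>, if present, is conjugated.
\<close>

locale twists =
  fixes r p n :: nat
  assumes r: "2 \<le> r" and n: "n = Suc r \<or> n = Suc (Suc r)" and p: "0 < p"
begin

abbreviation "F \<equiv> free_group_rank n"
abbreviation "A \<equiv> free_group_rank (Suc r)"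
abbreviation "h \<equiv> hword p"

sublocale F: group F by (rule group_free_group)
sublocale A: group A by (rule group_free_group)

lemma r_less: "r < n"
  using n by auto

lemma A_F: "x \<in> carrier A \<Longrightarrow> x \<in> carrier F"
  using n by (elim free_group_mono[rotated]) auto

lemma mult_A: "x \<otimes>\<^bsub>A\<^esub> y = x \<otimes>\<^bsub>F\<^esub> y"
  by (simp add: mult_free_group)

lemma inv_A: "x \<in> carrier A \<Longrightarrow> inv\<^bsub>A\<^esub> x = inv\<^bsub>F\<^esub> x"
  using A_F by (simp add: inv_free_group)

lemma pinned_F: "x \<in> carrier (free_group_rank r) \<Longrightarrow> x \<in> carrier F"
  using n by (elim free_group_mono[rotated]) auto

lemma h_pinned: "h \<in> carrier (free_group_rank r)"
  using r by (intro hword_carrier) auto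

lemma h_A: "h \<in> carrier A"
  using r by (intro hword_carrier) auto

lemmas h_F = A_F[OF h_A]

lemma pow_A: "x \<in> carrier A \<Longrightarrow> x [^]\<^bsub>F\<^esub> (m::int) \<in> carrier A"
proof -
  have "subgroup (carrier A) F" using n by (intro free_group_subgroup) auto
  then show "x \<in> carrier A \<Longrightarrow> x [^]\<^bsub>F\<^esub> (m::int) \<in> carrier A"
    by (rule F.subgroup_int_pow_closed)
qed

section \<open>Twists and their composition\<close>

definition image_gen :: "int \<Rightarrow> (nat \<times> bool) list \<Rightarrow> nat \<Rightarrow> (nat \<times> bool) list"
  where "image_gen m g i =
    (if i = r then h [^]\<^bsub>F\<^esub> m \<otimes>\<^bsub>F\<^esub> gen r
     else if i = Suc r then g \<otimes>\<^bsub>F\<^esub> gen (Suc r) \<otimes>\<^bsub>F\<^esub> inv\<^bsub>F\<^esub> g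
     else gen i)"

definition twist :: "int \<Rightarrow> (nat \<times> bool) list \<Rightarrow> (nat \<times> bool) list \<Rightarrow> (nat \<times> bool) list"
  where "twist m g = lift F {..<n} (image_gen m g)"

lemma image_gen_F: "g \<in> carrier A \<Longrightarrow> image_gen m g \<in> {..<n} \<rightarrow> carrier F"
  using h_F A_F by (auto simp: image_gen_def intro!: F.m_closed F.int_pow_closed F.inv_closed)

lemma
  assumes "g \<in> carrier A"
  shows twist_hom: "twist m g \<in> hom F F"
    and twist_gen: "\<And>i. i < n \<Longrightarrow> twist m g (gen i) = image_gen m g i"
    and twist_extensional: "twist m g \<in> extensional (carrier F)"
  unfolding twist_def
  using lift_hom[OF group_free_group image_gen_F[OF assms]]
    lift_gen[OF group_free_group image_gen_F[OF assms]]
    lift_extensional[OF group_free_group image_gen_F[OF assms]] by auto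

lemma twist_group_hom: "g \<in> carrier A \<Longrightarrow> group_hom F F (twist m g)"
  using twist_hom by unfold_locales

lemma twist_pinned:
  assumes "g \<in> carrier A" "x \<in> carrier (free_group_rank r)"
  shows "twist m g x = x"
proof (rule hom_free_group_eqI[of F _ "{..<r}" "\<lambda>x. x"])
  show "twist m g \<in> hom (free_group_rank r) F"
    using n by (intro hom_free_group_subset[OF twist_hom[OF assms(1)]]) auto
  show "(\<lambda>x. x) \<in> hom (free_group_rank r) F"
    using pinned_F by (auto simp: hom_def mult_free_group)
  show "twist m g (gen x) = gen x" if "x \<in> {..<r}" for x
    using that n twist_gen[OF assms(1), of x] by (auto simp: image_gen_def)
qed (use assms group_free_group in auto)

lemma nil_A [simp]: "[] \<in> carrier A"
  by (simp add: carrier_free_group)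

lemma nil_mult [simp]: "[] \<otimes>\<^bsub>F\<^esub> x = x"
  by (simp add: mult_free_group)

lemma twist_hom_A: "g \<in> carrier A \<Longrightarrow> twist m g \<in> hom A F"
  using n by (intro hom_free_group_subset[OF twist_hom]) auto

text \<open>The conjugator affects only \<open>gen (Suc r)\<close>, which does not occur in words of
  \<open>A\<close>. The action on \<open>A\<close> depends on \<open>m\<close> alone and is written
  with the default conjugator \<open>[]\<close>.\<close>

lemma twist_A_eq:
  assumes "g \<in> carrier A" "x \<in> carrier A"
  shows "twist m g x = twist m [] x"
proof (rule hom_free_group_eqI[of F "twist m g" "{..<Suc r}" "twist m []"])
  show "twist m g (gen x) = twist m [] (gen x)" if "x \<in> {..<Suc r}" for x
    using that n twist_gen[OF assms(1), of x] twist_gen[OF nil_A, of x] by (auto simp: image_gen_def)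
qed (use assms twist_hom_A group_free_group in auto)

lemma twist_gen_A:
  assumes "i < Suc r" "g \<in> carrier A"
  shows "twist m g (gen i) \<in> carrier A"
proof (cases "i = r")
  case True
  have "h [^]\<^bsub>F\<^esub> m \<otimes>\<^bsub>A\<^esub> gen r \<in> carrier A"
    by (rule A.m_closed[OF pow_A[OF h_A]]) simp
  then show ?thesis
    using twist_gen[OF assms(2) r_less, of m] by (simp add: True image_gen_def mult_A)
next
  case False
  then show ?thesis
    using twist_pinned[OF assms(2), of "gen i" m] assms(1) by simp
qed

lemma twist_A_closed:
  assumes "g \<in> carrier A" "x \<in> carrier A"
  shows "twist m g x \<in> carrier A"
  using assms(2)
proof (induction rule: free_group_induct)
  interpret t: group_hom F F "twist m g" using assms(1) by (rule twist_group_hom)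
  case one
  then show ?case using t.hom_one by (simp add: one_free_group)
next
  interpret t: group_hom F F "twist m g" using assms(1) by (rule twist_group_hom)
  case (gen i w)
  have i: "gen i \<in> carrier F" using gen n by auto
  have "twist m g (gen i \<otimes>\<^bsub>F\<^esub> w) = twist m g (gen i) \<otimes>\<^bsub>A\<^esub> twist m g w"
    using t.hom_mult[OF i A_F[OF gen(2)]] by (simp add: mult_A)
  then show ?case
    using A.m_closed[OF twist_gen_A[OF _ assms(1)] gen(3)] gen(1) by (simp add: mult_A)
next
  interpret t: group_hom F F "twist m g" using assms(1) by (rule twist_group_hom)
  case (inv i w)
  have i: "gen i \<in> carrier F" "gen i \<in> carrier A" using inv n by auto
  have tw: "twist m g (gen i) \<in> carrier A" using twist_gen_A[OF _ assms(1)] inv(1) by simp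
  have "twist m g (inv\<^bsub>F\<^esub> (gen i) \<otimes>\<^bsub>F\<^esub> w) = inv\<^bsub>F\<^esub> (twist m g (gen i)) \<otimes>\<^bsub>F\<^esub> twist m g w"
    using t.hom_mult[OF F.inv_closed[OF i(1)] A_F[OF inv(2)]] t.hom_inv[OF i(1)] by simp
  then show ?case
    using A.m_closed[OF A.inv_closed[OF tw] inv(3)] i(2) tw by (simp add: mult_A inv_A)
qed

text \<open>Exponents add because \<open>h\<close> is fixed. Twisting a conjugate of the last
  generator twists its conjugator and then conjugates further by \<open>g\<close>, which gives a
  semidirect product law with the conjugators in reverse order.\<close>

lemma twist_comp:
  assumes g: "g \<in> carrier A" "g' \<in> carrier A" and x: "x \<in> carrier F"
  shows "twist m g (twist m' g' x) = twist (m + m') (twist m [] g' \<otimes>\<^bsub>F\<^esub> g) x"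
proof -
  interpret t: group_hom F F "twist m g" using g(1) by (rule twist_group_hom)
  let ?g = "twist m [] g' \<otimes>\<^bsub>F\<^esub> g"
  have g'': "?g \<in> carrier A"
    using A.m_closed[OF twist_A_closed[OF nil_A g(2)] g(1)] by (simp add: mult_A)
  have tg': "twist m [] g' \<in> carrier F" by (intro A_F twist_A_closed nil_A g)
  have th: "twist m g h = h" by (rule twist_pinned[OF g(1) h_pinned])
  have "compose (carrier F) (twist m g) (twist m' g') x = twist (m + m') ?g x"
  proof (rule hom_free_group_eqI[of F "compose (carrier F) (twist m g) (twist m' g')" "{..<n}"
        "twist (m + m') ?g"])
    show "compose (carrier F) (twist m g) (twist m' g') \<in> hom F F"
      using twist_hom[OF g(1)] twist_hom[OF g(2)] by (rule F.hom_compose[rotated])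
    show "twist (m + m') ?g \<in> hom F F" by (rule twist_hom[OF g''])
    fix i assume i: "i \<in> {..<n}"
    then have c: "gen i \<in> carrier F" by simp
    consider "i = r" | "i = Suc r" | "i \<noteq> r" "i \<noteq> Suc r" by blast
    then have "twist m g (twist m' g' (gen i)) = twist (m + m') ?g (gen i)"
    proof cases
      case 1
      have "twist m g (twist m' g' (gen i)) = twist m g (h [^]\<^bsub>F\<^esub> m' \<otimes>\<^bsub>F\<^esub> gen r)"
        using i twist_gen[OF g(2), of i] 1 by (simp add: image_gen_def)
      also have "\<dots> = h [^]\<^bsub>F\<^esub> m' \<otimes>\<^bsub>F\<^esub> (h [^]\<^bsub>F\<^esub> m \<otimes>\<^bsub>F\<^esub> gen r)"
        using c 1 h_F th t.hom_int_pow[OF h_F, of m'] twist_gen[OF g(1), of i] i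
        by (simp add: image_gen_def)
      also have "\<dots> = h [^]\<^bsub>F\<^esub> (m + m') \<otimes>\<^bsub>F\<^esub> gen r"
        using c 1 h_F by (simp add: F.m_assoc[symmetric] F.int_pow_mult[symmetric] add.commute)
      also have "\<dots> = twist (m + m') ?g (gen i)"
        using i twist_gen[OF g'', of i] 1 by (simp add: image_gen_def)
      finally show ?thesis .
    next
      case 2
      let ?t = "gen (Suc r)"
      have t: "?t \<in> carrier F" using c 2 by simp
      have "twist m g (twist m' g' (gen i)) = twist m g (g' \<otimes>\<^bsub>F\<^esub> ?t \<otimes>\<^bsub>F\<^esub> inv\<^bsub>F\<^esub> g')"
        using i twist_gen[OF g(2), of i] 2 by (simp add: image_gen_def)
      also have "\<dots> = twist m g g' \<otimes>\<^bsub>F\<^esub> twist m g ?t \<otimes>\<^bsub>F\<^esub> inv\<^bsub>F\<^esub> (twist m g g')"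
        using t A_F[OF g(2)] by (simp del: gen_in_carrier)
      also have "\<dots> = twist m [] g' \<otimes>\<^bsub>F\<^esub> (g \<otimes>\<^bsub>F\<^esub> ?t \<otimes>\<^bsub>F\<^esub> inv\<^bsub>F\<^esub> g) \<otimes>\<^bsub>F\<^esub> inv\<^bsub>F\<^esub> (twist m [] g')"
        using twist_A_eq[OF g] twist_gen[OF g(1), of i] i 2 by (simp add: image_gen_def)
      also have "\<dots> = ?g \<otimes>\<^bsub>F\<^esub> ?t \<otimes>\<^bsub>F\<^esub> inv\<^bsub>F\<^esub> ?g"
        using t tg' A_F[OF g(1)] by (simp add: F.m_assoc F.inv_mult_group del: gen_in_carrier)
      also have "\<dots> = twist (m + m') ?g (gen i)"
        using i twist_gen[OF g'', of i] 2 by (simp add: image_gen_def)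
      finally show ?thesis .
    next
      case 3
      then show ?thesis
        using i twist_gen[OF g(1), of i] twist_gen[OF g(2), of i] twist_gen[OF g'', of i]
        by (simp add: image_gen_def)
    qed
    with c show "compose (carrier F) (twist m g) (twist m' g') (gen i) = twist (m + m') ?g (gen i)"
      by (simp add: compose_def)
  qed (use x group_free_group in auto)
  with x show ?thesis by (simp add: compose_def)
qed

lemma twist_zero:
  assumes "x \<in> carrier F"
  shows "twist 0 [] x = x"
proof (rule hom_free_group_eqI[of F _ "{..<n}" "\<lambda>x. x"])
  show "twist 0 [] (gen i) = gen i" if "i \<in> {..<n}" for i
    using that twist_gen[OF nil_A, of i 0] F.r_one[of "gen i"] h_F
    by (auto simp: image_gen_def one_free_group inv_free_group mult_free_group carrier_free_group)
qed (use assms twist_hom group_free_group in \<open>auto simp: hom_def\<close>)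

lemma twist_auto:
  assumes "g \<in> carrier A"
  shows "twist m g \<in> auto F"
proof -
  \<comment> \<open>The inverse under the law of \<open>twist_comp\<close>: exponent
    \<open>- m\<close>, and as conjugator the inverse of \<open>g\<close> twisted by
    \<open>- m\<close>.\<close>
  let ?g = "twist (- m) [] (inv\<^bsub>A\<^esub> g)"
  have ig: "inv\<^bsub>A\<^esub> g \<in> carrier A" using assms by simp
  have g': "?g \<in> carrier A" by (rule twist_A_closed[OF nil_A ig])
  interpret t: group_hom F F "twist (- m) []" by (rule twist_group_hom[OF nil_A])
  have 1: "twist m [] ?g = inv\<^bsub>A\<^esub> g"
    using twist_comp[OF nil_A nil_A A_F[OF ig], of m "- m"] twist_zero[OF A_F[OF ig]]
      group_hom.hom_one[OF twist_group_hom[OF nil_A, of m]]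
    by (simp add: one_free_group)
  have "inv\<^bsub>A\<^esub> g \<otimes>\<^bsub>F\<^esub> g = []"
    using A.l_inv[OF assms] by (simp add: mult_A one_free_group)
  then have "twist m g (twist (- m) ?g x) = x" if "x \<in> carrier F" for x
    using twist_comp[OF assms g' that, of m "- m"] 1 twist_zero[OF that] by simp
  moreover have "twist (- m) [] g \<otimes>\<^bsub>F\<^esub> ?g = []"
    using t.hom_mult[OF A_F[OF assms] A_F[OF ig]] A.r_inv[OF assms] t.hom_one
    by (simp add: mult_A[symmetric] one_free_group)
  then have "twist (- m) ?g (twist m g x) = x" if "x \<in> carrier F" for x
    using twist_comp[OF g' assms that, of "- m" m] twist_zero[OF that] by simp
  ultimately have "bij_betw (twist m g) (carrier F) (carrier F)"
    using twist_hom[OF assms, of m] twist_hom[OF g', of "- m"]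
    by (intro bij_betw_byWitness[where f' = "twist (- m) ?g"]) (auto simp: hom_def)
  then show ?thesis
    using twist_hom[OF assms] twist_extensional[OF assms] by (simp add: auto_def Bij_def)
qed

section \<open>The family of subgroups and its McCool group\<close>

definition H0 :: "(nat \<times> bool) list set"
  where "H0 = generate F (gen ` {..<r} \<union> {inv\<^bsub>F\<^esub> (gen r) \<otimes>\<^bsub>F\<^esub> h \<otimes>\<^bsub>F\<^esub> gen r})"

definition H1 :: "(nat \<times> bool) list set"
  where "H1 = generate F {gen (Suc r)}"

text \<open>The smaller rank serves the conjugacy statement. In the larger one, \<open>H1\<close>
  forces the additional generator to go to a conjugate of itself, which brings a copy of
  \<open>A\<close> into the McCool group.\<close>

definition family :: "(nat \<times> bool) list set set"
  where "family = (if n = Suc r then {H0} else {H0, H1})"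

lemma r_F: "gen r \<in> carrier F"
  using r_less by simp

lemma gens_H0: "gen ` {..<r} \<union> {inv\<^bsub>F\<^esub> (gen r) \<otimes>\<^bsub>F\<^esub> h \<otimes>\<^bsub>F\<^esub> gen r} \<subseteq> carrier F"
proof -
  have "inv\<^bsub>F\<^esub> (gen r) \<otimes>\<^bsub>F\<^esub> h \<otimes>\<^bsub>F\<^esub> gen r \<in> carrier F"
    by (intro F.m_closed F.inv_closed h_F r_F)
  then show ?thesis using n by auto
qed

lemma gens_H1: "n = Suc (Suc r) \<Longrightarrow> {gen (Suc r)} \<subseteq> carrier F"
  by auto

lemma family_fg:
  assumes "H \<in> family"
  shows "subgroup H F \<and> finitely_generated F H"
proof -
  have "finitely_generated F H0"
    unfolding finitely_generated_def
    by (intro exI conjI) (rule gens_H0, simp, rule H0_def)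
  moreover have "finitely_generated F H1" if "n = Suc (Suc r)"
    unfolding finitely_generated_def
    by (intro exI conjI) (rule gens_H1[OF that], simp, rule H1_def)
  moreover have "subgroup H0 F"
    unfolding H0_def by (rule F.generate_is_subgroup[OF gens_H0])
  moreover have "subgroup H1 F" if "n = Suc (Suc r)"
    unfolding H1_def by (rule F.generate_is_subgroup[OF gens_H1[OF that]])
  moreover have "H = H0 \<or> H = H1 \<and> n = Suc (Suc r)"
    using assms n unfolding family_def by (cases "n = Suc r") simp_all
  ultimately show ?thesis by blast
qed

text \<open>Both sides are homomorphisms in \<open>x\<close>, so agreement on generators extends to
  the generated subgroup.\<close>

lemma generate_hom_eq:
  assumes "group_hom F F \<phi>" "S \<subseteq> carrier F" "g \<in> carrier F"
    and "\<And>x. x \<in> S \<Longrightarrow> \<phi> x = g \<otimes>\<^bsub>F\<^esub> x \<otimes>\<^bsub>F\<^esub> inv\<^bsub>F\<^esub> g"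
    and "x \<in> generate F S"
  shows "\<phi> x = g \<otimes>\<^bsub>F\<^esub> x \<otimes>\<^bsub>F\<^esub> inv\<^bsub>F\<^esub> g"
  using assms(5)
proof induction
  interpret \<phi>: group_hom F F \<phi> by fact
  case one
  then show ?case using assms(3) \<phi>.hom_one by simp
next
  case (incl x)
  then show ?case by (rule assms(4))
next
  interpret \<phi>: group_hom F F \<phi> by fact
  case (inv x)
  then have x: "x \<in> carrier F" using assms(2) by auto
  show ?case using assms(4)[OF inv] x assms(3) \<phi>.hom_inv[OF x]
    by (simp add: F.inv_mult_group F.m_assoc)
next
  interpret \<phi>: group_hom F F \<phi> by fact
  case (eng x y)
  have xy: "x \<in> carrier F" "y \<in> carrier F"
    using eng F.generate_in_carrier[OF assms(2)] by auto
  have "inv\<^bsub>F\<^esub> g \<otimes>\<^bsub>F\<^esub> (g \<otimes>\<^bsub>F\<^esub> z) = z" if "z \<in> carrier F" for z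
    using that assms(3) by (simp flip: F.m_assoc)
  then show ?case
    using eng xy assms(3) \<phi>.hom_mult[OF xy] by (simp add: F.m_assoc)
qed

text \<open>Powers of \<open>h\<close> commute with \<open>h\<close>, so multiplying
  \<open>gen r\<close> by one on the left does not change the conjugate of \<open>h\<close> by
  \<open>gen r\<close>.\<close>

lemma twist_fixes_H0:
  assumes "g \<in> carrier A" "x \<in> H0"
  shows "twist m g x = x"
proof -
  interpret t: group_hom F F "twist m g" using assms(1) by (rule twist_group_hom)
  let ?k = "h [^]\<^bsub>F\<^esub> m"
  have k: "?k \<in> carrier F" using h_F by simp
  have comm: "inv\<^bsub>F\<^esub> ?k \<otimes>\<^bsub>F\<^esub> h \<otimes>\<^bsub>F\<^esub> ?k = h"
  proof -
    have "h \<otimes>\<^bsub>F\<^esub> ?k = ?k \<otimes>\<^bsub>F\<^esub> h"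
      using F.int_pow_mult[OF h_F, of 1 m] F.int_pow_mult[OF h_F, of m 1] h_F
      by (simp add: add.commute)
    then show ?thesis using h_F k by (simp add: F.m_assoc) (simp flip: F.m_assoc)
  qed
  have "twist m g (inv\<^bsub>F\<^esub> (gen r) \<otimes>\<^bsub>F\<^esub> h \<otimes>\<^bsub>F\<^esub> gen r) =
      inv\<^bsub>F\<^esub> (?k \<otimes>\<^bsub>F\<^esub> gen r) \<otimes>\<^bsub>F\<^esub> h \<otimes>\<^bsub>F\<^esub> (?k \<otimes>\<^bsub>F\<^esub> gen r)"
    using r_F h_F twist_gen[OF assms(1), of r m] n twist_pinned[OF assms(1) h_pinned]
    by (auto simp: image_gen_def simp del: gen_in_carrier)
  also have "\<dots> = inv\<^bsub>F\<^esub> (gen r) \<otimes>\<^bsub>F\<^esub> (inv\<^bsub>F\<^esub> ?k \<otimes>\<^bsub>F\<^esub> h \<otimes>\<^bsub>F\<^esub> ?k) \<otimes>\<^bsub>F\<^esub> gen r"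
    using r_F h_F k by (simp add: F.m_assoc F.inv_mult_group del: gen_in_carrier)
  finally have c: "twist m g (inv\<^bsub>F\<^esub> (gen r) \<otimes>\<^bsub>F\<^esub> h \<otimes>\<^bsub>F\<^esub> gen r) = inv\<^bsub>F\<^esub> (gen r) \<otimes>\<^bsub>F\<^esub> h \<otimes>\<^bsub>F\<^esub> gen r"
    unfolding comm .
  have S: "twist m g y = y"
    if "y \<in> gen ` {..<r} \<union> {inv\<^bsub>F\<^esub> (gen r) \<otimes>\<^bsub>F\<^esub> h \<otimes>\<^bsub>F\<^esub> gen r}" for y
    using that c twist_pinned[OF assms(1)] by auto
  \<comment> \<open>Being the identity is expressed as conjugation by the unit so that
    \<open>generate_hom_eq\<close> applies.\<close>
  have "twist m g x = \<one>\<^bsub>F\<^esub> \<otimes>\<^bsub>F\<^esub> x \<otimes>\<^bsub>F\<^esub> inv\<^bsub>F\<^esub> \<one>\<^bsub>F\<^esub>"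
  proof (rule generate_hom_eq[OF twist_group_hom[OF assms(1)] gens_H0])
    fix y assume y: "y \<in> gen ` {..<r} \<union> {inv\<^bsub>F\<^esub> (gen r) \<otimes>\<^bsub>F\<^esub> h \<otimes>\<^bsub>F\<^esub> gen r}"
    then have "y \<in> carrier F" using gens_H0 by blast
    with S[OF y] show "twist m g y = \<one>\<^bsub>F\<^esub> \<otimes>\<^bsub>F\<^esub> y \<otimes>\<^bsub>F\<^esub> inv\<^bsub>F\<^esub> \<one>\<^bsub>F\<^esub>" by simp
  qed (use assms in \<open>auto simp: H0_def\<close>)
  moreover have "x \<in> carrier F"
    using assms(2) F.generate_in_carrier[OF gens_H0] by (simp add: H0_def)
  ultimately show ?thesis by simp
qed

lemma twist_acts_trivially:
  assumes "g \<in> carrier A"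
  shows "acts_trivially_on F family (twist m g)"
proof -
  have "\<exists>k\<in>carrier F. \<forall>x\<in>H0. twist m g x = k \<otimes>\<^bsub>F\<^esub> x \<otimes>\<^bsub>F\<^esub> inv\<^bsub>F\<^esub> k"
  proof (intro bexI[of _ "\<one>\<^bsub>F\<^esub>"] ballI)
    fix x assume "x \<in> H0"
    then show "twist m g x = \<one>\<^bsub>F\<^esub> \<otimes>\<^bsub>F\<^esub> x \<otimes>\<^bsub>F\<^esub> inv\<^bsub>F\<^esub> \<one>\<^bsub>F\<^esub>"
      using twist_fixes_H0[OF assms] F.generate_in_carrier[OF gens_H0] by (simp add: H0_def)
  qed simp
  moreover have "\<exists>k\<in>carrier F. \<forall>x\<in>H1. twist m g x = k \<otimes>\<^bsub>F\<^esub> x \<otimes>\<^bsub>F\<^esub> inv\<^bsub>F\<^esub> k"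
    if "n = Suc (Suc r)"
  proof (intro bexI[of _ g] ballI)
    have lt: "Suc r < n" using that by simp
    fix x assume "x \<in> H1"
    then show "twist m g x = g \<otimes>\<^bsub>F\<^esub> x \<otimes>\<^bsub>F\<^esub> inv\<^bsub>F\<^esub> g"
      unfolding H1_def
      by (rule generate_hom_eq[OF twist_group_hom[OF assms] gens_H1[OF that] A_F[OF assms], rotated])
        (use twist_gen[OF assms lt] in \<open>simp add: image_gen_def\<close>)
  qed (rule A_F[OF assms])
  ultimately show ?thesis using n by (auto simp: acts_trivially_on_def family_def)
qed

text \<open>The centralizer of \<open>h\<close> determines the image of \<open>gen r\<close>, and
  surjectivity of \<open>\<phi>\<close> puts the conjugator of the last generator into
  \<open>A\<close>.\<close>

lemma fixes_H0_imp_twist: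
  assumes \<phi>: "\<phi> \<in> auto F" and fixed: "\<forall>x\<in>H0. \<phi> x = x" and triv: "acts_trivially_on F family \<phi>"
  shows "\<exists>m. \<exists>g\<in>carrier A. \<phi> = twist m g"
proof -
  interpret \<phi>: group_hom F F \<phi> using autoD(1)[OF \<phi>] by unfold_locales
  let ?c = "gen r" and ?d = "\<phi> (gen r)"
  have d: "?d \<in> carrier F" using r_F by simp
  have pinned: "\<phi> x = x" if "x \<in> carrier (free_group_rank r)" for x
  proof (rule hom_free_group_eqI[of F _ "{..<r}" "\<lambda>x. x"])
    show "\<phi> \<in> hom (free_group_rank r) F"
      using n by (intro hom_free_group_subset[OF autoD(1)[OF \<phi>]]) auto
    show "(\<lambda>x. x) \<in> hom (free_group_rank r) F"
      using pinned_F by (auto simp: hom_def mult_free_group)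
    show "\<phi> (gen x) = gen x" if "x \<in> {..<r}" for x
      using fixed that by (auto simp: H0_def intro!: generate.incl)
  qed (use that group_free_group in auto)
  have "inv\<^bsub>F\<^esub> ?d \<otimes>\<^bsub>F\<^esub> h \<otimes>\<^bsub>F\<^esub> ?d = inv\<^bsub>F\<^esub> ?c \<otimes>\<^bsub>F\<^esub> h \<otimes>\<^bsub>F\<^esub> ?c"
  proof -
    have "inv\<^bsub>F\<^esub> ?c \<otimes>\<^bsub>F\<^esub> h \<otimes>\<^bsub>F\<^esub> ?c \<in> H0"
      unfolding H0_def by (rule generate.incl) simp
    with fixed have "\<phi> (inv\<^bsub>F\<^esub> ?c \<otimes>\<^bsub>F\<^esub> h \<otimes>\<^bsub>F\<^esub> ?c) = inv\<^bsub>F\<^esub> ?c \<otimes>\<^bsub>F\<^esub> h \<otimes>\<^bsub>F\<^esub> ?c" by blast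
    then show ?thesis using r_F h_F pinned[OF h_pinned] by (simp del: gen_in_carrier)
  qed
  \<comment> \<open>Multiplying by \<open>?d\<close> on the left and by the inverse of
    \<open>?c\<close> on the right turns the equation into commutation of their quotient with
    \<open>h\<close>.\<close>
  then have "?d \<otimes>\<^bsub>F\<^esub> (inv\<^bsub>F\<^esub> ?d \<otimes>\<^bsub>F\<^esub> h \<otimes>\<^bsub>F\<^esub> ?d) \<otimes>\<^bsub>F\<^esub> inv\<^bsub>F\<^esub> ?c =
      ?d \<otimes>\<^bsub>F\<^esub> (inv\<^bsub>F\<^esub> ?c \<otimes>\<^bsub>F\<^esub> h \<otimes>\<^bsub>F\<^esub> ?c) \<otimes>\<^bsub>F\<^esub> inv\<^bsub>F\<^esub> ?c" by simp
  moreover have "?d \<otimes>\<^bsub>F\<^esub> (inv\<^bsub>F\<^esub> ?d \<otimes>\<^bsub>F\<^esub> h \<otimes>\<^bsub>F\<^esub> ?d) \<otimes>\<^bsub>F\<^esub> inv\<^bsub>F\<^esub> ?c =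
      (?d \<otimes>\<^bsub>F\<^esub> inv\<^bsub>F\<^esub> ?d) \<otimes>\<^bsub>F\<^esub> (h \<otimes>\<^bsub>F\<^esub> (?d \<otimes>\<^bsub>F\<^esub> inv\<^bsub>F\<^esub> ?c))"
    using d r_F h_F by (simp only: F.m_assoc F.m_closed F.inv_closed)
  moreover have "?d \<otimes>\<^bsub>F\<^esub> (inv\<^bsub>F\<^esub> ?c \<otimes>\<^bsub>F\<^esub> h \<otimes>\<^bsub>F\<^esub> ?c) \<otimes>\<^bsub>F\<^esub> inv\<^bsub>F\<^esub> ?c =
      (?d \<otimes>\<^bsub>F\<^esub> inv\<^bsub>F\<^esub> ?c) \<otimes>\<^bsub>F\<^esub> (h \<otimes>\<^bsub>F\<^esub> (?c \<otimes>\<^bsub>F\<^esub> inv\<^bsub>F\<^esub> ?c))"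
    using d r_F h_F by (simp only: F.m_assoc F.m_closed F.inv_closed)
  ultimately have "(?d \<otimes>\<^bsub>F\<^esub> inv\<^bsub>F\<^esub> ?c) \<otimes>\<^bsub>F\<^esub> h = h \<otimes>\<^bsub>F\<^esub> (?d \<otimes>\<^bsub>F\<^esub> inv\<^bsub>F\<^esub> ?c)"
    using d r_F h_F by (simp del: gen_in_carrier)
  moreover have "{0, 1} \<subseteq> {..<n}" using r n by auto
  ultimately obtain m :: int where "?d \<otimes>\<^bsub>F\<^esub> inv\<^bsub>F\<^esub> ?c = h [^]\<^bsub>F\<^esub> m"
    using centralizer_hword[OF _ p, of "{..<n}" "?d \<otimes>\<^bsub>F\<^esub> inv\<^bsub>F\<^esub> ?c"] d r_F
    by (auto simp del: gen_in_carrier)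
  then have m: "?d = h [^]\<^bsub>F\<^esub> m \<otimes>\<^bsub>F\<^esub> ?c"
    using d r_F by (metis F.inv_closed F.inv_solve_right F.int_pow_closed h_F)
  \<comment> \<open>The implication treats both ranks at once; \<open>[]\<close> is the default
    conjugator when there is no generator \<open>Suc r\<close>.\<close>
  have "\<exists>g\<in>carrier A. n = Suc (Suc r) \<longrightarrow>
      \<phi> (gen (Suc r)) = g \<otimes>\<^bsub>F\<^esub> gen (Suc r) \<otimes>\<^bsub>F\<^esub> inv\<^bsub>F\<^esub> g"
  proof (cases "n = Suc (Suc r)")
    case True
    have B: "{..<n} = insert (Suc r) {..<Suc r}" using True by auto
    have t: "gen (Suc r) \<in> carrier F" using True by simp
    have "gen (Suc r) \<in> H1" unfolding H1_def by (rule generate.incl) simp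
    moreover have "H1 \<in> family" unfolding family_def using True by simp
    ultimately obtain k where "k \<in> carrier F" "\<phi> (gen (Suc r)) = k \<otimes>\<^bsub>F\<^esub> gen (Suc r) \<otimes>\<^bsub>F\<^esub> inv\<^bsub>F\<^esub> k"
      using triv unfolding acts_trivially_on_def by blast
    moreover have "gen (Suc r) \<in> \<phi> ` carrier F"
      using autoD(2)[OF \<phi>] t by (simp add: bij_betw_def del: gen_in_carrier)
    moreover have "\<phi> (gen x) \<in> carrier A" if "x \<in> {..<Suc r}" for x
    proof (cases "x = r")
      case True
      then show ?thesis
        using m A.m_closed[OF pow_A[OF h_A], of "gen r" m] by (simp add: mult_A)
    next
      case False
      then show ?thesis using pinned[of "gen x"] that by simp
    qed
    ultimately show ?thesis
      using conj_gen_in_factor[of "Suc r" "{..<Suc r}" \<phi> k] autoD(1)[OF \<phi>] unfolding B by auto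
  qed (use nil_A in blast)
  then obtain g where g: "g \<in> carrier A"
    "n = Suc (Suc r) \<Longrightarrow> \<phi> (gen (Suc r)) = g \<otimes>\<^bsub>F\<^esub> gen (Suc r) \<otimes>\<^bsub>F\<^esub> inv\<^bsub>F\<^esub> g" by blast
  have "\<phi> x = twist m g x" if "x \<in> carrier F" for x
  proof (rule hom_free_group_eqI[of F \<phi> "{..<n}" "twist m g"])
    show "\<phi> (gen i) = twist m g (gen i)" if "i \<in> {..<n}" for i
      using that n twist_gen[OF g(1), of i m] m g(2) pinned[of "gen i"]
      by (auto simp: image_gen_def)
  qed (use that group_free_group autoD(1)[OF \<phi>] twist_hom[OF g(1)] in auto)
  then have "\<phi> = twist m g"
    by (rule extensionalityI[OF autoD(3)[OF \<phi>] twist_extensional[OF g(1)]])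
  with g(1) show ?thesis by blast
qed

definition mccool :: "((nat \<times> bool) list \<Rightarrow> (nat \<times> bool) list) set set"
  where "mccool = Mc F family"

lemma McCool_mccool: "McCool_group F mccool"
  unfolding McCool_group_def mccool_def using family_fg
  by (intro exI[of _ family]) (auto simp: family_def)

lemma mccool_eq: "mccool = outer F ` {twist m g | m g. g \<in> carrier A}"
proof -
  have "{\<phi> \<in> auto F. (\<forall>h\<in>H0. \<phi> h = h) \<and> acts_trivially_on F family \<phi>} =
      {twist m g | m g. g \<in> carrier A}"
    using fixes_H0_imp_twist twist_auto twist_fixes_H0 twist_acts_trivially by auto blast
  moreover have "H \<subseteq> carrier F" if "H \<in> family" for H
    using family_fg[OF that] subgroup.subset by blast
  ultimately show ?thesis
    unfolding mccool_def by (subst F.Mc_eq_fixing[of H0]) (auto simp: family_def)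
qed

text \<open>The twist changes the exponent sum of \<open>gen r\<close> by a multiple of that of
  \<open>h\<close>, which vanishes modulo \<open>j\<close> by assumption; the other generators of
  \<open>A\<close> are fixed.\<close>

lemma exponent_sum_twist:
  assumes "g \<in> carrier A" "x \<in> carrier A" "[int p * (v 0 + v 1) = 0] (mod j)"
  shows "[exponent_sum v (twist m g x) = exponent_sum v x] (mod j)"
proof (rule additive_mod_eqI[of j "{..<Suc r}" "\<lambda>x. exponent_sum v (twist m g x)"])
  interpret t: group_hom F F "twist m g" using assms(1) by (rule twist_group_hom)
  show "additive_mod j A (\<lambda>x. exponent_sum v (twist m g x))"
    using A_F by (simp add: additive_mod_def mult_A)
  fix i assume i: "i \<in> {..<Suc r}"
  show "[exponent_sum v (twist m g (gen i)) = exponent_sum v (gen i)] (mod j)"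
  proof (cases "i = r")
    case True
    have "[m * (int p * (v 0 + v 1)) + v r = 0 + v r] (mod j)"
      using cong_mult[OF cong_refl assms(3), of m] by (intro cong_add) simp_all
    then show ?thesis
      using twist_gen[OF assms(1) r_less, of m]
      by (simp add: True image_gen_def exponent_sum_int_pow[OF h_F] exponent_sum_hword)
  next
    case False
    then show ?thesis using i twist_gen[OF assms(1), of i m] n by (auto simp: image_gen_def)
  qed
qed (use assms additive_mod_exponent_sum in auto)

section \<open>The homology criterion for conjugacy\<close>

text \<open>In this rank \<open>A\<close> is all of \<open>F\<close>. The twist with
  \<open>m = 1\<close> adds \<open>p\<close> times the classes of the generators \<open>0\<close>
  and \<open>1\<close> to that of \<open>gen r\<close>, and other twists add multiples of
  this.\<close>

lemma mccool_homology:
  assumes "n = Suc r"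
  shows "outer_homology_trivial j F mccool \<longleftrightarrow> j dvd int p"
proof -
  have "outer_homology_trivial j F mccool \<longleftrightarrow>
      (\<forall>m. \<forall>g\<in>carrier A. homology_trivial j F (twist m g))"
    unfolding mccool_eq using twist_auto by (subst F.outer_homology_trivial_image) blast+
  also have "\<dots> \<longleftrightarrow> j dvd int p"
  proof
    \<comment> \<open>This weight counts generator \<open>0\<close> only: it is \<open>p\<close> on
      \<open>h\<close>, and it vanishes on \<open>gen r\<close> because
      \<open>2 \<le> r\<close>.\<close>
    let ?v = "\<lambda>i::nat. if i = 0 then 1 else (0::int)"
    assume "\<forall>m. \<forall>g\<in>carrier A. homology_trivial j F (twist m g)"
    then have "homology_trivial j F (twist 1 [])" using nil_A by blast
    then have "[exponent_sum ?v (twist 1 [] (gen r)) = exponent_sum ?v (gen r)] (mod j)"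
      using r_F additive_mod_exponent_sum unfolding homology_trivial_def by blast
    then have "[int p = 0] (mod j)"
      using r h_F twist_gen[OF nil_A r_less, of 1] by (simp add: image_gen_def exponent_sum_hword)
    then show "j dvd int p" by (simp add: cong_0_iff)
  next
    assume dvd: "j dvd int p"
    have "homology_trivial j F (twist m g)" if g: "g \<in> carrier A" for m g
      unfolding homology_trivial_def
    proof (intro allI impI ballI)
      fix f x assume f: "additive_mod j F f" and x: "x \<in> carrier F"
      let ?v = "\<lambda>i. f (gen i)"
      have "[int p * (?v 0 + ?v 1) = 0] (mod j)"
        using dvd by (simp add: cong_0_iff)
      then have "[exponent_sum ?v (twist m g x) = exponent_sum ?v x] (mod j)"
        using exponent_sum_twist[OF g, of x ?v j m] x assms by simp
      with additive_mod_eq_exponent_sum[OF f autoD(4)[OF twist_auto[OF g] x]]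
        additive_mod_eq_exponent_sum[OF f x, THEN cong_sym]
      show "[f (twist m g x) = f x] (mod j)" by (blast intro: cong_trans)
    qed
    then show "\<forall>m. \<forall>g\<in>carrier A. homology_trivial j F (twist m g)" by blast
  qed
  finally show ?thesis .
qed

section \<open>The McCool group as an extension of \<int> by A\<close>

text \<open>These are the coordinates of the twists, multiplied by the law of
  \<open>twist_comp\<close>.\<close>

definition twist_ext :: "(int \<times> (nat \<times> bool) list) monoid"
  where "twist_ext = \<lparr>carrier = UNIV \<times> carrier A,
    monoid.mult = (\<lambda>(m, g) (m', g'). (m + m', twist m [] g' \<otimes>\<^bsub>F\<^esub> g)), monoid.one = (0, [])\<rparr>"

lemma twist_ext_simps:
  "x \<in> carrier twist_ext \<longleftrightarrow> snd x \<in> carrier A"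
  "(m, g) \<otimes>\<^bsub>twist_ext\<^esub> (m', g') = (m + m', twist m [] g' \<otimes>\<^bsub>F\<^esub> g)"
  by (auto simp: twist_ext_def mem_Times_iff)

lemma twist_mult_A: "g \<in> carrier A \<Longrightarrow> g' \<in> carrier A \<Longrightarrow> twist m [] g' \<otimes>\<^bsub>F\<^esub> g \<in> carrier A"
  using A.m_closed[OF twist_A_closed[OF nil_A]] by (simp add: mult_A)

lemma twist_ext_closed:
  "x \<in> carrier twist_ext \<Longrightarrow> y \<in> carrier twist_ext \<Longrightarrow> x \<otimes>\<^bsub>twist_ext\<^esub> y \<in> carrier twist_ext"
  by (cases x; cases y) (simp add: twist_ext_simps twist_mult_A)

lemma outer_twist_mult:
  assumes "g \<in> carrier A" "g' \<in> carrier A"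
  shows "outer F (twist m g) \<otimes>\<^bsub>Out F\<^esub> outer F (twist m' g') =
    outer F (twist (m + m') (twist m [] g' \<otimes>\<^bsub>F\<^esub> g))"
proof -
  have "compose (carrier F) (twist m g) (twist m' g') = twist (m + m') (twist m [] g' \<otimes>\<^bsub>F\<^esub> g)"
    by (rule extensionalityI[OF compose_extensional twist_extensional[OF twist_mult_A[OF assms]]])
      (simp add: compose_def twist_comp[OF assms])
  then have "twist m g \<otimes>\<^bsub>AutoGroup F\<^esub> twist m' g' = twist (m + m') (twist m [] g' \<otimes>\<^bsub>F\<^esub> g)"
    using twist_auto assms by (simp add: AutoGroup_simps)
  then show ?thesis
    using hom_mult[OF F.outer_hom, of "twist m g" "twist m' g'"] twist_auto assms
    by (simp add: AutoGroup_simps)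
qed

text \<open>An inner automorphism relating two twists is trivial, so they agree as maps. The image
  of \<open>gen r\<close> then determines the exponent, and the image of the last generator
  determines the conjugator up to its centralizer, which meets \<open>A\<close> trivially.\<close>

lemma outer_twist_eqD:
  assumes n2: "n = Suc (Suc r)" and g: "g \<in> carrier A" "g' \<in> carrier A"
    and eq: "outer F (twist m g) = outer F (twist m' g')"
  shows "m = m' \<and> g = g'"
proof -
  obtain z where z: "z \<in> carrier F"
    and tw: "\<And>x. x \<in> carrier F \<Longrightarrow> twist m g x = z \<otimes>\<^bsub>F\<^esub> twist m' g' x \<otimes>\<^bsub>F\<^esub> inv\<^bsub>F\<^esub> z"
    using iffD1[OF F.outer_eq_iff[OF twist_auto[OF g(2)] twist_auto[OF g(1)]] eq] by metis
  have comm: "z \<otimes>\<^bsub>F\<^esub> gen i = gen i \<otimes>\<^bsub>F\<^esub> z" if "i < r" for i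
  proof -
    have i: "gen i \<in> carrier (free_group_rank r)" using that by simp
    then have "gen i = z \<otimes>\<^bsub>F\<^esub> gen i \<otimes>\<^bsub>F\<^esub> inv\<^bsub>F\<^esub> z"
      using tw[OF pinned_F[OF i]] twist_pinned[OF _ i] g by simp
    then show ?thesis
      using F.inv_solve_right[of "gen i" "z \<otimes>\<^bsub>F\<^esub> gen i" z] z pinned_F[OF i]
      by (simp del: gen_in_carrier)
  qed
  have nil: "[] = \<one>\<^bsub>F\<^esub>" by (simp add: one_free_group)
  \<comment> \<open>Both twists fix the generators \<open>0\<close> and \<open>1\<close>, pinned
    because \<open>2 \<le> r\<close>, so \<open>z\<close> commutes with both.\<close>
  have "z = []"
    by (rule centralizer_two_gens_trivial[of 0 "{..<n}" 1 z]) (use r r_less z comm in auto)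
  then have tw': "twist m g x = twist m' g' x" if "x \<in> carrier F" for x
    using tw[OF that] autoD(4)[OF twist_auto[OF g(2)] that, of m']
    by (simp add: nil)
  let ?v = "\<lambda>i::nat. if i = 0 then 1 else (0::int)"
  have "h [^]\<^bsub>F\<^esub> m \<otimes>\<^bsub>F\<^esub> gen r = h [^]\<^bsub>F\<^esub> m' \<otimes>\<^bsub>F\<^esub> gen r"
    using tw'[OF r_F] twist_gen[OF _ r_less] g by (simp add: image_gen_def)
  then have "exponent_sum ?v (h [^]\<^bsub>F\<^esub> m \<otimes>\<^bsub>F\<^esub> gen r) = exponent_sum ?v (h [^]\<^bsub>F\<^esub> m' \<otimes>\<^bsub>F\<^esub> gen r)"
    by (rule arg_cong)
  then have m: "m = m'"
    using p by (simp add: exponent_sum_int_pow[OF h_F] exponent_sum_hword)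
  let ?t = "gen (Suc r)"
  have lt: "Suc r < n" and t: "?t \<in> carrier F" using n2 by auto
  let ?k = "inv\<^bsub>F\<^esub> g' \<otimes>\<^bsub>F\<^esub> g"
  have kA: "?k \<in> carrier A"
    using A.m_closed[OF A.inv_closed[OF g(2)] g(1)] g by (simp add: mult_A inv_A)
  have k: "?k \<in> carrier F" by (rule A_F[OF kA])
  have eqt: "g \<otimes>\<^bsub>F\<^esub> ?t \<otimes>\<^bsub>F\<^esub> inv\<^bsub>F\<^esub> g = g' \<otimes>\<^bsub>F\<^esub> ?t \<otimes>\<^bsub>F\<^esub> inv\<^bsub>F\<^esub> g'"
    using tw'[OF t] twist_gen[OF _ lt] g by (simp add: image_gen_def)
  have "?k \<otimes>\<^bsub>F\<^esub> ?t = inv\<^bsub>F\<^esub> g' \<otimes>\<^bsub>F\<^esub> (g \<otimes>\<^bsub>F\<^esub> ?t \<otimes>\<^bsub>F\<^esub> inv\<^bsub>F\<^esub> g) \<otimes>\<^bsub>F\<^esub> g"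
    using A_F[OF g(1)] A_F[OF g(2)] t by (simp add: F.m_assoc del: gen_in_carrier)
  also have "\<dots> = (inv\<^bsub>F\<^esub> g' \<otimes>\<^bsub>F\<^esub> g') \<otimes>\<^bsub>F\<^esub> (?t \<otimes>\<^bsub>F\<^esub> ?k)"
    unfolding eqt using A_F[OF g(1)] A_F[OF g(2)] t
    by (simp only: F.m_assoc F.m_closed F.inv_closed)
  also have "\<dots> = ?t \<otimes>\<^bsub>F\<^esub> ?k"
    using A_F[OF g(2)] t k by (simp del: gen_in_carrier)
  finally have "fst ` set ?k \<subseteq> {Suc r}"
    using lt k by (intro centralizer_gen[of "Suc r" "{..<n}"]) auto
  moreover have "fst ` set ?k \<subseteq> {..<Suc r}"
    using kA by (simp add: carrier_free_group)
  ultimately have "?k = \<one>\<^bsub>F\<^esub>"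
    by (cases ?k) (auto simp: one_free_group)
  moreover have "g' \<otimes>\<^bsub>F\<^esub> ?k = g"
    using A_F[OF g(1)] A_F[OF g(2)] by (simp flip: F.m_assoc)
  ultimately have "g = g'"
    using A_F[OF g(2)] by simp
  with m show ?thesis by simp
qed

lemma twist_ext_iso:
  assumes "n = Suc (Suc r)"
  shows "(\<lambda>(m, g). outer F (twist m g)) \<in> iso twist_ext ((Out F)\<lparr>carrier := mccool\<rparr>)"
proof -
  have "(\<lambda>(m, g). outer F (twist m g)) \<in> hom twist_ext ((Out F)\<lparr>carrier := mccool\<rparr>)"
    by (rule homI) (auto simp: twist_ext_simps mccool_eq outer_twist_mult intro!: imageI, blast)
  moreover have "bij_betw (\<lambda>(m, g). outer F (twist m g)) (carrier twist_ext) mccool"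
    unfolding bij_betw_def
  proof
    show "inj_on (\<lambda>(m, g). outer F (twist m g)) (carrier twist_ext)"
      using outer_twist_eqD[OF assms] by (auto simp: inj_on_def twist_ext_simps)
    show "(\<lambda>(m, g). outer F (twist m g)) ` carrier twist_ext = mccool"
      by (auto simp: mccool_eq twist_ext_simps image_iff) force
  qed
  ultimately show ?thesis by (simp add: iso_def)
qed

text \<open>
  Conjugating the twist with \<open>m = 1\<close> by the element \<open>gen r\<close> of the kernel shows that \<open>hword p\<close>
  dies in every abelian quotient.
\<close>

lemma
  assumes f: "additive_mod j twist_ext f"
  shows twist_ext_restrict: "additive_mod j A (\<lambda>x. f (0, x))"
    and twist_ext_relation: "[int p * (f (0, gen 0) + f (0, gen 1)) = 0] (mod j)"
proof -
  have mult: "[f (m + m', twist m [] g' \<otimes>\<^bsub>F\<^esub> g) = f (m, g) + f (m', g')] (mod j)"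
    if "g \<in> carrier A" "g' \<in> carrier A" for m m' g g'
    using additive_modD[OF f, of "(m, g)" "(m', g')"] that by (simp add: twist_ext_simps)
  show add: "additive_mod j A (\<lambda>x. f (0, x))"
    unfolding additive_mod_def
  proof (intro ballI)
    fix x y assume xy: "x \<in> carrier A" "y \<in> carrier A"
    show "[f (0, x \<otimes>\<^bsub>A\<^esub> y) = f (0, x) + f (0, y)] (mod j)"
      \<comment> \<open>The factors are swapped since the law of \<open>twist_ext\<close> reverses
        the multiplication of \<open>A\<close>.\<close>
      using mult[OF xy(2,1), of 0 0] twist_zero[OF A_F[OF xy(1)]] by (simp add: mult_A add.commute)
  qed
  let ?c = "gen r"
  have c: "?c \<in> carrier A" by simp
  have hc: "h \<otimes>\<^bsub>A\<^esub> ?c \<in> carrier A" using h_A c by (rule A.m_closed)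
  have tc: "twist 1 [] ?c = h \<otimes>\<^bsub>A\<^esub> ?c"
    using twist_gen[OF nil_A r_less, of 1] h_F by (simp add: image_gen_def mult_A)
  have nil: "x \<otimes>\<^bsub>F\<^esub> [] = x" if "x \<in> carrier A" for x
    using F.r_one[OF A_F[OF that]] by (simp add: one_free_group)
  have t0: "twist 0 [] [] = []" using twist_zero[OF A_F[OF nil_A]] .
  \<comment> \<open>The same element \<open>(1, h c)\<close> is written as
    \<open>(1, []) (0, c)\<close> and as \<open>(0, h c) (1, [])\<close>; comparing the values
    leaves the value on \<open>h\<close>.\<close>
  have "[f (1, h \<otimes>\<^bsub>A\<^esub> ?c) = f (1, []) + f (0, ?c)] (mod j)"
    using mult[OF nil_A c, of 1 0] tc nil[OF hc] by simp
  moreover have "[f (1, h \<otimes>\<^bsub>A\<^esub> ?c) = f (0, h \<otimes>\<^bsub>A\<^esub> ?c) + f (1, [])] (mod j)"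
    using mult[OF hc nil_A, of 0 1] t0 by simp
  moreover have "[f (0, h \<otimes>\<^bsub>A\<^esub> ?c) + f (1, []) = f (0, h) + f (0, ?c) + f (1, [])] (mod j)"
    using additive_modD[OF add h_A c] by (intro cong_add) simp_all
  ultimately have "[f (1, []) + f (0, ?c) = f (0, h) + f (0, ?c) + f (1, [])] (mod j)"
    by (meson cong_sym cong_trans)
  then have "[0 + (f (1, []) + f (0, ?c)) = f (0, h) + (f (1, []) + f (0, ?c))] (mod j)"
    by (simp add: algebra_simps)
  then have "[f (0, h) = 0] (mod j)"
    unfolding cong_add_rcancel by (rule cong_sym)
  with additive_mod_eq_exponent_sum[OF add h_A]
  have "[exponent_sum (\<lambda>x. f (0, gen x)) h = 0] (mod j)"
    by (meson cong_sym cong_trans)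
  then show "[int p * (f (0, gen 0) + f (0, gen 1)) = 0] (mod j)"
    by (simp add: exponent_sum_hword)
qed

section \<open>Torsion in the abelianization of the extension\<close>

text \<open>Conversely, the relation on the weights suffices to build a homomorphism: by
  \<open>exponent_sum_twist\<close> the twisting is then invisible, and the value \<open>s\<close>
  on \<open>(1, [])\<close> is free.\<close>

lemma additive_mod_twist_ext_exponent_sum:
  assumes "[int p * (v 0 + v 1) = 0] (mod j)"
  shows "additive_mod j twist_ext (\<lambda>(m, g). m * s + exponent_sum v g)"
  unfolding additive_mod_def
proof (intro ballI)
  fix x y assume xy: "x \<in> carrier twist_ext" "y \<in> carrier twist_ext"
  obtain m g m' g' where [simp]: "x = (m, g)" "y = (m', g')" by (cases x; cases y)
  have "g' \<in> carrier A" using xy by (simp add: twist_ext_simps)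
  from exponent_sum_twist[where m = m, OF nil_A this assms]
  have "[m * s + m' * s + exponent_sum v g + exponent_sum v (twist m [] g') =
      m * s + m' * s + exponent_sum v g + exponent_sum v g'] (mod j)"
    by (intro cong_add) simp_all
  then show "[(case x \<otimes>\<^bsub>twist_ext\<^esub> y of (m, g) \<Rightarrow> m * s + exponent_sum v g) =
      (case x of (m, g) \<Rightarrow> m * s + exponent_sum v g) +
      (case y of (m, g) \<Rightarrow> m * s + exponent_sum v g)] (mod j)"
    by (simp add: twist_ext_simps algebra_simps)
qed

text \<open>Modulo \<open>p\<close> the relation holds for all weights, so the generators
  \<open>0\<close> and \<open>1\<close> may be sent to \<open>1\<close> and \<open>0\<close>.
  Integral values must add up to zero, which is not \<open>1\<close> modulo
  \<open>p\<close>.\<close>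

lemma twist_ext_not_lifts:
  assumes "1 < p"
  shows "\<not> lifts_homs_mod (int p) twist_ext"
proof
  assume L: "lifts_homs_mod (int p) twist_ext"
  let ?v = "\<lambda>i::nat. if i = 0 then 1 else (0::int)"
  let ?f = "\<lambda>(m, g). m * 0 + exponent_sum ?v g"
  have "additive_mod (int p) twist_ext ?f"
    by (rule additive_mod_twist_ext_exponent_sum) (simp add: cong_0_iff)
  with L obtain f where f: "additive_mod 0 twist_ext f"
    "\<And>x. x \<in> carrier twist_ext \<Longrightarrow> [f x = ?f x] (mod int p)"
    unfolding lifts_homs_mod_def by blast
  have "int p * (f (0, gen 0) + f (0, gen 1)) = 0"
    using twist_ext_relation[OF f(1)] by simp
  then have sum: "f (0, gen 0) + f (0, gen 1) = 0" using p by simp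
  have "[f (0, gen 0) = 1] (mod int p)" "[f (0, gen 1) = 0] (mod int p)"
    using f(2)[of "(0, gen 0)"] f(2)[of "(0, gen 1)"] r by (simp_all add: twist_ext_simps)
  then have "[f (0, gen 0) + f (0, gen 1) = 1 + 0] (mod int p)" by (rule cong_add)
  then have "[1 = 0] (mod int p)" using sum by (simp add: cong_sym)
  then show False using assms by (simp add: cong_0_iff)
qed

text \<open>When \<open>q\<close> is coprime to \<open>p\<close>, the factor \<open>p\<close> can be
  cancelled from the relation, and the values on the generators can be corrected modulo
  \<open>q\<close> to satisfy it over the integers.\<close>

lemma twist_ext_lifts:
  assumes "coprime (int p) q"
  shows "lifts_homs_mod q twist_ext"
  unfolding lifts_homs_mod_def
proof (intro allI impI)
  fix f assume f: "additive_mod q twist_ext f"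
  define u where "u i = f (0, gen i)" for i
  \<comment> \<open>Replacing the value at \<open>1\<close> by the negative of the value at
    \<open>0\<close> makes the integral relation exact.\<close>
  define v where "v i = (if i = 1 then - u 0 else u i)" for i
  define F where "F = (\<lambda>(m, g). m * f (1, []) + exponent_sum v g)"
  have "additive_mod 0 twist_ext F"
    unfolding F_def by (rule additive_mod_twist_ext_exponent_sum) (simp add: v_def)
  moreover have "[F x = f x] (mod q)" if x: "x \<in> carrier twist_ext" for x
  proof -
    obtain m g where mg: "x = (m, g)" by (cases x)
    then have g: "g \<in> carrier A" using x by (simp add: twist_ext_simps)
    have t0: "twist k [] [] = []" for k
      using group_hom.hom_one[OF twist_group_hom[OF nil_A]] by (simp add: one_free_group)
    have "q dvd u 0 + u 1"
      using twist_ext_relation[OF f] assms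
      by (simp add: u_def cong_0_iff coprime_dvd_mult_right_iff coprime_commute)
    then have "[u 1 = v 1] (mod q)"
      by (simp add: v_def cong_iff_dvd_diff add.commute)
    then have uv: "[exponent_sum v g = exponent_sum u g] (mod q)"
      by (intro exponent_sum_cong) (auto simp: v_def cong_sym)
    have fu: "[exponent_sum u g = f (0, g)] (mod q)"
      using additive_mod_eq_exponent_sum[OF twist_ext_restrict[OF f] g]
      unfolding u_def by (rule cong_sym)
    have mult: "[f (k + l, []) = f (k, []) + f (l, [])] (mod q)" for k l
      using additive_modD[OF f, of "(k, [])" "(l, [])"] t0[of k] by (simp add: twist_ext_simps)
    have "[f (0, []) = 0] (mod q)"
      using mult[of 0 0] cong_add_lcancel_0[of "f (0, [])" "f (0, [])" q] by (simp add: cong_sym_eq)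
    \<comment> \<open>Induction from \<open>0\<close> in both directions determines \<open>f\<close>
      on the \<int> coordinate.\<close>
    have pow: "[k * f (1, []) = f (k, [])] (mod q)" for k
    proof (induction k rule: int_induct[of _ 0])
      case base
      then show ?case using \<open>[f (0, []) = 0] (mod q)\<close> by (simp add: cong_sym)
    next
      case (step1 k)
      have "[k * f (1, []) + f (1, []) = f (k, []) + f (1, [])] (mod q)"
        using step1(2) by (intro cong_add) simp_all
      from cong_trans[OF this cong_sym[OF mult[of k 1]]] show ?case by (simp add: algebra_simps)
    next
      case (step2 k)
      have "[(k - 1) * f (1, []) + f (1, []) = f (k, [])] (mod q)"
        using step2(2) by (simp add: algebra_simps)
      from cong_trans[OF this] mult[of "k - 1" 1]
      have "[(k - 1) * f (1, []) + f (1, []) = f (k - 1, []) + f (1, [])] (mod q)" by simp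
      then show ?case by (simp only: cong_add_rcancel)
    qed
    \<comment> \<open>This uses the factorization of \<open>(m, g)\<close> as
      \<open>(0, g) (m, [])\<close>.\<close>
    have "[f (m, g) = f (m, []) + f (0, g)] (mod q)"
      using additive_modD[OF f, of "(0, g)" "(m, [])"] g t0[of 0]
      by (simp add: twist_ext_simps add.commute)
    moreover have "[m * f (1, []) + exponent_sum v g = f (m, []) + f (0, g)] (mod q)"
      by (rule cong_add[OF pow cong_trans[OF uv fu]])
    ultimately show ?thesis
      unfolding mg F_def prod.case by (blast intro: cong_sym cong_trans)
  qed
  ultimately show "\<exists>F. additive_mod 0 twist_ext F \<and> (\<forall>x\<in>carrier twist_ext. [F x = f x] (mod q))"
    by blast
qed

lemma mccool_lifts_homs_mod:
  assumes "n = Suc (Suc r)" "prime p" "prime q"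
  shows "lifts_homs_mod (int q) ((Out F)\<lparr>carrier := mccool\<rparr>) \<longleftrightarrow> q \<noteq> p"
proof -
  have "lifts_homs_mod (int q) ((Out F)\<lparr>carrier := mccool\<rparr>) \<longleftrightarrow> lifts_homs_mod (int q) twist_ext"
    using lifts_homs_mod_iso[OF twist_ext_iso[OF assms(1)] twist_ext_closed] by simp
  also have "\<dots> \<longleftrightarrow> q \<noteq> p"
    using twist_ext_not_lifts twist_ext_lifts[of "int q"] primes_coprime[OF assms(2,3)]
      prime_gt_1_nat[OF assms(2)] by auto
  finally show ?thesis .
qed

text \<open>This supplies the closure premise of \<open>lifts_homs_mod_iso\<close> for an
  isomorphism between two McCool groups.\<close>

lemma mccool_closed:
  assumes "x \<in> mccool" "y \<in> mccool"
  shows "x \<otimes>\<^bsub>Out F\<^esub> y \<in> mccool"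
  using assms by (auto simp: mccool_eq outer_twist_mult) (use twist_mult_A in blast)

end

section \<open>Infinitely many McCool groups, indexed by the primes\<close>

theorem proposition1p7:
  fixes n :: nat
  shows "(n \<ge> 4 \<longrightarrow>
      (\<exists>\<M>. infinite \<M> \<and> (\<forall>A\<in>\<M>. McCool_group (free_group_rank n) A) \<and>
        pairwise (\<lambda>A B. \<not> (Out (free_group_rank n))\<lparr>carrier := A\<rparr>
                            \<cong> (Out (free_group_rank n))\<lparr>carrier := B\<rparr>) \<M>)) \<and>
    (n \<ge> 3 \<longrightarrow>
      (\<exists>\<M>. infinite \<M> \<and> (\<forall>A\<in>\<M>. McCool_group (free_group_rank n) A) \<and>
        pairwise (\<lambda>A B. \<not> conjugate_subgroups (Out (free_group_rank n)) A B) \<M>))"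
proof (intro conjI impI)
  let ?F = "free_group_rank n"
  assume n: "n \<ge> 4"
  \<comment> \<open>Two generators are reserved for \<open>c\<close> and \<open>t\<close>;
    \<open>n \<ge> 4\<close> leaves at least the two pinned generators that occur in
    \<open>hword p\<close>.\<close>
  define r where "r = n - 2"
  define M where "M p = twists.mccool r p n" for p
  have tw: "twists r p n" if "prime p" for p
    using that n prime_gt_0_nat by unfold_locales (auto simp: r_def)
  have nr: "n = Suc (Suc r)" using n by (simp add: r_def)
  have lifts: "lifts_homs_mod (int q) ((Out ?F)\<lparr>carrier := M p\<rparr>) \<longleftrightarrow> q \<noteq> p"
    if "prime p" "prime q" for p q
    unfolding M_def using twists.mccool_lifts_homs_mod[OF tw nr] that by blast
  have not_iso: "\<not> (Out ?F)\<lparr>carrier := M p\<rparr> \<cong> (Out ?F)\<lparr>carrier := M q\<rparr>"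
    if "prime p" "prime q" "p \<noteq> q" for p q
  proof
    assume "(Out ?F)\<lparr>carrier := M p\<rparr> \<cong> (Out ?F)\<lparr>carrier := M q\<rparr>"
    then obtain \<theta> where "\<theta> \<in> iso ((Out ?F)\<lparr>carrier := M p\<rparr>) ((Out ?F)\<lparr>carrier := M q\<rparr>)"
      by (auto simp: is_iso_def)
    then have "lifts_homs_mod (int q) ((Out ?F)\<lparr>carrier := M p\<rparr>) \<longleftrightarrow>
        lifts_homs_mod (int q) ((Out ?F)\<lparr>carrier := M q\<rparr>)"
      by (rule lifts_homs_mod_iso) (use twists.mccool_closed[OF tw[OF that(1)]] in \<open>simp add: M_def\<close>)
    then show False using lifts that by blast
  qed
  \<comment> \<open>The invariant recovers \<open>p\<close> from the group, so distinct primes give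
    distinct members of the collection.\<close>
  have "inj_on M {p. prime p}"
    using lifts by (intro inj_onI) (metis mem_Collect_eq)
  then have "infinite (M ` {p. prime p})"
    using primes_infinite by (simp add: finite_image_iff)
  then show "\<exists>\<M>. infinite \<M> \<and> (\<forall>A\<in>\<M>. McCool_group ?F A) \<and>
      pairwise (\<lambda>A B. \<not> (Out ?F)\<lparr>carrier := A\<rparr> \<cong> (Out ?F)\<lparr>carrier := B\<rparr>) \<M>"
    using not_iso twists.McCool_mccool[OF tw]
    by (intro exI[of _ "M ` {p. prime p}"]) (auto simp: pairwise_def M_def)
next
  let ?F = "free_group_rank n"
  assume n: "n \<ge> 3"
  \<comment> \<open>Only \<open>c\<close> is reserved here, so \<open>n \<ge> 3\<close> already
    leaves two pinned generators.\<close>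
  define r where "r = n - 1"
  define M where "M p = twists.mccool r p n" for p
  have tw: "twists r p n" if "prime p" for p
    using that n prime_gt_0_nat by unfold_locales (auto simp: r_def)
  have nr: "n = Suc r" using n by (simp add: r_def)
  have triv: "outer_homology_trivial (int q) ?F (M p) \<longleftrightarrow> q = p"
    if "prime p" "prime q" for p q
    unfolding M_def using twists.mccool_homology[OF tw nr] that primes_dvd_imp_eq by auto
  have not_conj: "\<not> conjugate_subgroups (Out ?F) (M p) (M q)"
    if "prime p" "prime q" "p \<noteq> q" for p q
  proof
    assume conj: "conjugate_subgroups (Out ?F) (M p) (M q)"
    have "M p \<subseteq> carrier (Out ?F)"
      unfolding M_def twists.mccool_def[OF tw[OF that(1)]] Mc_def by blast
    \<comment> \<open>Conjugacy would carry triviality modulo \<open>p\<close> from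
      \<open>M p\<close> to \<open>M q\<close>, which forces \<open>p = q\<close>.\<close>
    from group.outer_homology_trivial_conjugate[OF group_free_group conj this, of "int p"]
    show False using triv that by blast
  qed
  have "inj_on M {p. prime p}"
    using triv by (intro inj_onI) (metis mem_Collect_eq)
  then have "infinite (M ` {p. prime p})"
    using primes_infinite by (simp add: finite_image_iff)
  then show "\<exists>\<M>. infinite \<M> \<and> (\<forall>A\<in>\<M>. McCool_group ?F A) \<and>
      pairwise (\<lambda>A B. \<not> conjugate_subgroups (Out ?F) A B) \<M>"
    using not_conj twists.McCool_mccool[OF tw]
    by (intro exI[of _ "M ` {p. prime p}"]) (auto simp: pairwise_def M_def)
qed

end
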